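(* Let $N\ge1$ and let $A^{(N)}$ be a generator in a stable sandpile $\eta\in \Omega$ that has the form of an $N \times N$ square. The set of cornerstone vertices of $A^{(N)}$ is $$B^*_{A^{(N)}}(\eta) = \begin{cases} R_1(A^{(N)}), &\text{if } N = 1, 2, \\ R_2(A^{(N)}) \setminus C(A^{(N)}), &\text{if } N = 3, 4, \\ R_3(A^{(N)}) \setminus C\big(\bigcup_{i=1}^3 R_i(A^{(N)})\big), &\text{if } N \geq 5. \end{cases}$$
   Context: Fix an integer $L\ge 1$ and let $V=\{1,\ldots,L\}^2\subset\mathbb{Z}^2$, labelled $V=\{v_1,\ldots,v_{L^2}\}$. For $v,w\in V$ write $v\sim w$ if $v,w$ are nearest neighbours in $\mathbb{Z}^2$; connectedness of subsets of $V$ refers to this relation. All vertices of $\mathbb{Z}^2\setminus V$ are identified with a single sink; every $v\in V$ has four edges to its lattice neighbours, those leading outside $V$ going to the sink (grains sent there are discarded). A sandpile is a map $\eta:V\to\mathbb{Z}$. $\Omega$ is the set of stable sandpiles, i.e. those with $0\le\eta(v)<4$ for all $v\in V$. A vertex $v$ is critical in $\eta$ if $\eta(v)=3$. A generator in $\eta$ is a connected component (maximal connected set) of the set of critical vertices of $\eta$. The removal operator $\gamma_i$ sets $\eta(v_i)$ to $0$ and leaves all other values unchanged. Toppling a vertex $v\in V$ decreases $\eta(v)$ by $4$ and increases $\eta(w)$ by $1$ for each $w\in V$ with $w\sim v$; the toppling is legal if $\eta(v)>3$. Avalanche size: for $\eta\in\Omega$ and $v\in V$, $x(\eta,v)$ is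 the total number of topplings (counted with multiplicity) in any sequence of legal topplings that starts at the configuration obtained from $\eta$ by adding one grain at $v$ and ends at a stable configuration; this number is finite and independent of the sequence. $Y$ is uniformly distributed on $V$ (the vertex where the next grain lands) and $X(\eta)=x(\eta,Y)$, so for nonempty $B\subseteq V$, $\mathbb{E}[X(\eta)\mid Y\in B]=\frac{1}{|B|}\sum_{v\in B}x(\eta,v)$. Stability level and cornerstones: for $A\subseteq V$, the stability level is $\lambda(\eta,A)=\min_{v_i\in A}\frac{\mathbb{E}[X(\gamma_i\eta)\mid Y\in A]}{\mathbb{E}[X(\eta)\mid Y\in A]}$, and the set $B^*_A(\eta)$ of cornerstone vertices of $A$ is the set of all $v_i\in A$ for which this minimum is attained. Rings: for a square $B$ of side at least $3$, let $\delta^{\mathrm{in}}(B)$ (resp. $C(B)$) be the set of $v\in B$ having exactly one (resp. exactly two) nearest neighbours in $\mathbb{Z}^2$ outside $B$ (so $C(B)$ is the set of the four corners). For an $N\times N$ square $A$ with $N\ge3$ and $m=\lceil N/2\rceil$: $R_m(A)=\delta^{\mathrm{in}}(A)\cup C(A)$; for $j=m-1,\ldots,2$, $R_j(A)=\delta^{\mathrm{in}}(A_j)\cup C(A_j)$ with $A_j=A\setminus\bigcup_{k=j+1}^{m}R_k(A)$; and $R_1(A)=A\setminus\bigcup_{k=2}^{m}R_k(A)$. For $N\le 2$, $R_1(A)=A$. For $k\ge2$, $\bigcup_{j=1}^k R_j(A)$ is a concentric sub-square of $A$ with outermost layer $R_k(A)$. *)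

theory Defs
  imports "HOL-Probability.Probability"
begin

type_synonym vertex = "int \<times> int"

(* A sandpile on V is represented by a total function on the lattice; no definition
   below depends on its values outside V. *)
type_synonym sandpile = "vertex \<Rightarrow> int"

definition box :: "nat \<Rightarrow> vertex set" where
  "box L = {1..int L} \<times> {1..int L}"

definition adj :: "vertex \<Rightarrow> vertex \<Rightarrow> bool" where
  "adj v w \<longleftrightarrow> \<bar>fst v - fst w\<bar> + \<bar>snd v - snd w\<bar> = 1"

definition stable_sandpiles :: "nat \<Rightarrow> sandpile set" where
  "stable_sandpiles L = {\<eta>. \<forall>v\<in>box L. 0 \<le> \<eta> v \<and> \<eta> v < 4}"

definition critical_vertices :: "nat \<Rightarrow> sandpile \<Rightarrow> vertex set" where
  "critical_vertices L \<eta> = {v \<in> box L. \<eta> v = 3}"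

definition lattice_connected :: "vertex set \<Rightarrow> bool" where
  "lattice_connected S \<longleftrightarrow>
     (\<forall>v\<in>S. \<forall>w\<in>S. (v, w) \<in> {(a, b). a \<in> S \<and> b \<in> S \<and> adj a b}\<^sup>*)"

definition generator :: "nat \<Rightarrow> sandpile \<Rightarrow> vertex set \<Rightarrow> bool" where
  "generator L \<eta> A \<longleftrightarrow>
     A \<noteq> {} \<and> A \<subseteq> critical_vertices L \<eta> \<and> lattice_connected A \<and>
     (\<forall>S. A \<subseteq> S \<and> S \<subseteq> critical_vertices L \<eta> \<and> lattice_connected S \<longrightarrow> S = A)"

definition removal :: "vertex \<Rightarrow> sandpile \<Rightarrow> sandpile" where
  "removal v \<eta> = \<eta>(v := 0)"

definition add_grain :: "vertex \<Rightarrow> sandpile \<Rightarrow> sandpile" where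
  "add_grain v \<eta> = \<eta>(v := \<eta> v + 1)"

definition topple :: "nat \<Rightarrow> vertex \<Rightarrow> sandpile \<Rightarrow> sandpile" where
  "topple L v \<eta> = (\<lambda>w. if w = v then \<eta> w - 4
                       else if w \<in> box L \<and> adj v w then \<eta> w + 1
                       else \<eta> w)"

definition legal_toppling :: "nat \<Rightarrow> sandpile \<Rightarrow> sandpile \<Rightarrow> bool" where
  "legal_toppling L \<eta> \<zeta> \<longleftrightarrow> (\<exists>v\<in>box L. \<eta> v > 3 \<and> \<zeta> = topple L v \<eta>)"

(* THE is justified by the abelian property: every stabilizing sequence of legal
   topplings has the same length, and such a sequence exists. *)
definition avalanche_size :: "nat \<Rightarrow> sandpile \<Rightarrow> vertex \<Rightarrow> nat" where
  "avalanche_size L \<eta> v =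
     (THE n. \<exists>\<zeta>\<in>stable_sandpiles L. (legal_toppling L ^^ n) (add_grain v \<eta>) \<zeta>)"

(* E[X(eta) | Y in B], where Y is uniform on V and X(eta) = x(eta, Y);
   meaningful when B meets V. *)
definition expected_avalanche :: "nat \<Rightarrow> sandpile \<Rightarrow> vertex set \<Rightarrow> real" where
  "expected_avalanche L \<eta> B =
     measure_pmf.expectation (cond_pmf (pmf_of_set (box L)) B)
       (\<lambda>v. real (avalanche_size L \<eta> v))"

definition stability_ratio :: "nat \<Rightarrow> sandpile \<Rightarrow> vertex set \<Rightarrow> vertex \<Rightarrow> real" where
  "stability_ratio L \<eta> A v =
     expected_avalanche L (removal v \<eta>) A / expected_avalanche L \<eta> A"

definition stability_level :: "nat \<Rightarrow> sandpile \<Rightarrow> vertex set \<Rightarrow> real" where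
  "stability_level L \<eta> A = Min (stability_ratio L \<eta> A ` A)"

definition cornerstones :: "nat \<Rightarrow> sandpile \<Rightarrow> vertex set \<Rightarrow> vertex set" where
  "cornerstones L \<eta> A = {v \<in> A. stability_ratio L \<eta> A v = stability_level L \<eta> A}"

definition is_square :: "nat \<Rightarrow> vertex set \<Rightarrow> bool" where
  "is_square N A \<longleftrightarrow> (\<exists>a b. A = {a..<a + int N} \<times> {b..<b + int N})"

definition inner_boundary :: "vertex set \<Rightarrow> vertex set" where
  "inner_boundary B = {v \<in> B. card {w. adj v w \<and> w \<notin> B} = 1}"

definition corners :: "vertex set \<Rightarrow> vertex set" where
  "corners B = {v \<in> B. card {w. adj v w \<and> w \<notin> B} = 2}"

(* ring N A j is R_j(A) for an N x N square A; rings are numbered from the centre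
   outwards up to m = ceiling (N/2). For N \<le> 2 we have m = 1, so the case j = 1
   gives R_1(A) = A. Indices outside 1..m give the empty set. *)
function ring :: "nat \<Rightarrow> vertex set \<Rightarrow> nat \<Rightarrow> vertex set" where
  "ring N A j =
     (let m = nat \<lceil>real N / 2\<rceil> in
      if j = 1 then A - (\<Union>k\<in>{2..m}. ring N A k)
      else if 2 \<le> j \<and> j \<le> m then
        (let B = A - (\<Union>k\<in>{j+1..m}. ring N A k) in inner_boundary B \<union> corners B)
      else {})"
  by pat_completeness auto
termination
  by (relation "Wellfounded.measure (\<lambda>(N, A, j). nat \<lceil>real N / 2\<rceil> + 1 - j)") auto

declare ring.simps [simp del]

end

theory Submission
  imports Defs
begin

text \<open>
Count the layers of the square \<open>A\<close> from its boundary inwards and let \<open>depth w\<close> be the number of the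
layer of \<open>w\<close>, with depth 0 outside. A grain at \<open>v\<close> causes \<open>depth v\<close> waves: the first topples all
of \<open>A\<close> once, the second all of \<open>A\<close> but its outermost layer, and so on, until \<open>v\<close> lies on the
boundary of the square that topples. So \<open>w\<close> topples \<open>min (depth w) (depth v)\<close> times, and the size
of the avalanche is a sum \<open>total (depth v)\<close> of squares of numbers of the parity of \<open>N\<close>.

Now empty a vertex \<open>p\<close> of depth \<open>d\<close>. In the first \<open>d - 1\<close> waves all four neighbours of \<open>p\<close> topple, so
\<open>p\<close> topples too, and nothing changes. In wave \<open>d\<close> it lies on the boundary and does not topple. If \<open>p\<close>
is a corner of its layer, this toppling is lost for good and later waves are unaffected. Otherwise
\<open>p\<close> has a neighbour \<open>u\<close> of depth \<open>d + 1\<close>. If there is a next wave, \<open>u\<close> topples in it in spite of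
the grain it lacks, and hands to \<open>p\<close> the fourth grain: the lost toppling is made up for. But if the
grain lands at \<open>u\<close> itself, the grain missing there ends the avalanche, and a whole wave is lost.
Sizes and removals are treated in \<open>avalanche_intact\<close> and \<open>avalanche_removal\<close>.

Summing over the landing vertices (\<open>loss_eq\<close>), the removal at \<open>p\<close> costs
\<open>total d + (N - 2 * (d - 1))\<^sup>2\<close> topplings, and one less if \<open>p\<close> is a corner. From layer \<open>d\<close> to
\<open>d + 1\<close> this changes by \<open>(y - 2)\<^sup>2 - 8\<close>, where \<open>y = N - 2 * d\<close> is the side of the square inside
layer \<open>d\<close>. This is positive for \<open>y \<ge> 5\<close> and negative for \<open>y \<le> 4\<close>, so the cost is largest on the
layer whose square has side 5 or 6, the third ring from the centre, or on the outermost layer if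
\<open>N\<close> is 3 or 4; and there exactly at the vertices that are not corners. For \<open>N \<le> 2\<close> all vertices
are corners of a single layer and cost the same.

That the waves may be performed in this order rests on the connectedness of a square without one
vertex (\<open>punctured_square_connected\<close>), and that avalanche sizes can be read off from one particular
legal order rests on the diamond property of topplings (\<open>legal_toppling_diamond\<close>).
\<close>

section \<open>Odometers and legal firing\<close>

text \<open>
The discrete Laplacian of the square lattice: if every vertex \<open>w\<close> topples \<open>m w\<close> times, the
height of \<open>v\<close> changes by \<open>lap m v\<close>. Such an \<open>m\<close> is called an odometer.
\<close>

definition lap :: "(vertex \<Rightarrow> int) \<Rightarrow> vertex \<Rightarrow> int" where
  "lap m v = m (fst v + 1, snd v) + m (fst v - 1, snd v) + m (fst v, snd v + 1)
     + m (fst v, snd v - 1) - 4 * m v"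

definition fire :: "nat \<Rightarrow> (vertex \<Rightarrow> int) \<Rightarrow> sandpile \<Rightarrow> sandpile" where
  "fire L m \<zeta> = (\<lambda>w. if w \<in> box L then \<zeta> w + lap m w else \<zeta> w)"

text \<open>
The order of the topplings is existentially hidden in the relation power; only the odometer is
recorded. Its values are integers, although counts, because Laplacians are subtracted from one
another throughout.
\<close>

definition legal_firing :: "nat \<Rightarrow> sandpile \<Rightarrow> (vertex \<Rightarrow> int) \<Rightarrow> bool" where
  "legal_firing L \<zeta> m \<longleftrightarrow> (\<forall>w. 0 \<le> m w) \<and> (\<forall>w. w \<notin> box L \<longrightarrow> m w = 0) \<and>
     (legal_toppling L ^^ nat (\<Sum>w\<in>box L. m w)) \<zeta> (fire L m \<zeta>)"

lemma finite_box [simp]: "finite (box L)"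
  by (simp add: box_def)

lemma adj_sym: "adj v w \<longleftrightarrow> adj w v"
  by (auto simp: adj_def)

lemma adj_iff:
  "adj v w \<longleftrightarrow> w \<in> {(fst v + 1, snd v), (fst v - 1, snd v), (fst v, snd v + 1), (fst v, snd v - 1)}"
  by (cases v; cases w) (auto simp: adj_def)

lemma lap_add: "lap (\<lambda>w. f w + g w) v = lap f v + lap g v"
  by (simp add: lap_def algebra_simps)

lemma lap_of_bool_eq: "lap (\<lambda>w. of_bool (w = z)) v = of_bool (adj z v) - 4 * of_bool (v = z)"
  by (cases z; cases v) (auto simp: lap_def adj_sym[of z] adj_iff)

lemma fire_topple:
  assumes "z \<in> box L"
  shows "topple L z (fire L m \<zeta>) = fire L (\<lambda>w. m w + of_bool (w = z)) \<zeta>"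
  using assms by (auto simp: fun_eq_iff topple_def fire_def lap_add lap_of_bool_eq adj_def)

lemma legal_firing_zero: "legal_firing L \<zeta> (\<lambda>w. 0)"
  by (simp add: legal_firing_def fire_def lap_def fun_eq_iff)

lemma legal_firing_vertex:
  assumes m: "legal_firing L \<zeta> m" and z: "z \<in> box L" and un: "3 < fire L m \<zeta> z"
  shows "legal_firing L \<zeta> (\<lambda>w. m w + of_bool (w = z))"
proof -
  have "(\<Sum>w\<in>box L. m w + of_bool (w = z)) = (\<Sum>w\<in>box L. m w) + 1"
    using z by (simp add: sum.distrib of_bool_def)
  moreover have "0 \<le> (\<Sum>w\<in>box L. m w)"
    using m by (intro sum_nonneg) (auto simp: legal_firing_def)
  ultimately have len: "nat (\<Sum>w\<in>box L. m w + of_bool (w = z)) = Suc (nat (\<Sum>w\<in>box L. m w))"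
    by simp
  have "legal_toppling L (fire L m \<zeta>) (fire L (\<lambda>w. m w + of_bool (w = z)) \<zeta>)"
    unfolding legal_toppling_def using z un fire_topple[OF z, of m \<zeta>] by auto
  then show ?thesis
    using m z unfolding legal_firing_def len by (auto intro: relpowp_Suc_I)
qed

text \<open>
Toppling a set never lowers a vertex outside it, and raises each of its outer neighbours.
\<close>

lemma lap_of_bool_ge:
  assumes "z \<notin> S"
  shows "0 \<le> lap (\<lambda>w. of_bool (w \<in> S)) z"
    and "y \<in> S \<Longrightarrow> adj y z \<Longrightarrow> 1 \<le> lap (\<lambda>w. of_bool (w \<in> S)) z"
  using assms by (auto simp: lap_def adj_sym[of y] adj_iff)

text \<open>
One wave. In a region that is critical everywhere and unstable at \<open>v\<close>, the topplings can spread
from \<open>v\<close> until every vertex has toppled once: as long as the set \<open>S\<close> of toppled vertices is not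
the whole region, some vertex outside \<open>S\<close> is adjacent to \<open>S\<close>, hence has received a grain. The
connectedness of the region enters as the absence of an empty cut.
\<close>

lemma legal_firing_connected:
  assumes m: "legal_firing L \<zeta> m" and X: "X \<subseteq> box L"
    and cut: "\<And>S. S \<subset> X \<Longrightarrow> S \<noteq> {} \<Longrightarrow> \<exists>y\<in>S. \<exists>z\<in>X - S. adj y z"
    and v: "v \<in> X" "3 < fire L m \<zeta> v"
    and crit: "\<And>w. w \<in> X \<Longrightarrow> 3 \<le> fire L m \<zeta> w"
  shows "legal_firing L \<zeta> (\<lambda>w. m w + of_bool (w \<in> X))"
proof -
  have fin: "finite X" by (rule finite_subset[OF X finite_box])
  have "\<exists>S\<subseteq>X. card S = k \<and> legal_firing L \<zeta> (\<lambda>w. m w + of_bool (w \<in> S))" if "k \<le> card X" for k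
    using that
  proof (induction k)
    case 0
    then show ?case using m by (intro exI[of _ "{}"]) auto
  next
    case (Suc k)
    then obtain S where S: "S \<subseteq> X" "card S = k"
      and leg: "legal_firing L \<zeta> (\<lambda>w. m w + of_bool (w \<in> S))" by auto
    then have sub: "S \<subset> X" using Suc.prems by auto
    have add: "fire L (\<lambda>w. m w + of_bool (w \<in> S)) \<zeta> z
        = fire L m \<zeta> z + lap (\<lambda>w. of_bool (w \<in> S)) z" if "z \<in> X" for z
      using that X by (auto simp: fire_def lap_add)
    have "\<exists>z\<in>X - S. 3 < fire L (\<lambda>w. m w + of_bool (w \<in> S)) \<zeta> z"
    proof (cases "S = {}")
      case True
      then show ?thesis using v by auto
    next
      case False
      then obtain y z where yz: "y \<in> S" "z \<in> X - S" "adj y z" using cut[OF sub] by auto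
      then show ?thesis
        using add[of z] crit[of z] lap_of_bool_ge(2)[of z S y] by (intro bexI[of _ z]) auto
    qed
    then obtain z where z: "z \<in> X" "z \<notin> S"
      and un: "3 < fire L (\<lambda>w. m w + of_bool (w \<in> S)) \<zeta> z" by auto
    have "(\<lambda>w. m w + of_bool (w \<in> S) + of_bool (w = z)) = (\<lambda>w. m w + of_bool (w \<in> insert z S))"
      using z by (auto simp: fun_eq_iff)
    then have "legal_firing L \<zeta> (\<lambda>w. m w + of_bool (w \<in> insert z S))"
      using legal_firing_vertex[OF leg _ un] z X by auto
    moreover have "card (insert z S) = Suc k" using S z finite_subset[OF S(1) fin] by simp
    ultimately show ?case using z S by (intro exI[of _ "insert z S"]) auto
  qed
  from this[of "card X"] show ?thesis using card_subset_eq[OF fin] by auto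
qed

section \<open>The abelian property\<close>

text \<open>
Adding grains elsewhere does not make an unstable vertex stable, and topplings commute as
additions; so two different legal topplings can be performed one after the other in either
order. The diamond has sides of length one, which is why it controls the length of stabilizing
sequences as well as their end.
\<close>

lemma legal_toppling_diamond:
  assumes "legal_toppling L \<zeta> \<zeta>1" "legal_toppling L \<zeta> \<zeta>2" "\<zeta>1 \<noteq> \<zeta>2"
  shows "\<exists>\<xi>. legal_toppling L \<zeta>1 \<xi> \<and> legal_toppling L \<zeta>2 \<xi>"
proof -
  obtain v w where v: "v \<in> box L" "\<zeta> v > 3" "\<zeta>1 = topple L v \<zeta>"
    and w: "w \<in> box L" "\<zeta> w > 3" "\<zeta>2 = topple L w \<zeta>"
    using assms by (auto simp: legal_toppling_def)
  have "v \<noteq> w" using assms(3) v w by auto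
  then have "\<zeta>1 w > 3" "\<zeta>2 v > 3" using v w by (auto simp: topple_def)
  moreover have "topple L w \<zeta>1 = topple L v \<zeta>2"
    unfolding v(3) w(3) by (auto simp: topple_def fun_eq_iff)
  ultimately show ?thesis using v w unfolding legal_toppling_def by metis
qed

lemma stable_no_toppling:
  assumes "\<zeta> \<in> stable_sandpiles L"
  shows "\<not> legal_toppling L \<zeta> \<xi>"
proof
  assume "legal_toppling L \<zeta> \<xi>"
  then obtain v where "v \<in> box L" "\<zeta> v > 3" by (auto simp: legal_toppling_def)
  moreover have "\<zeta> v < 4" using assms \<open>v \<in> box L\<close> by (auto simp: stable_sandpiles_def)
  ultimately show False by simp
qed

text \<open>
Any legal first toppling is as good as the actual first one: closing the diamond along the
sequence saves exactly one step.
\<close>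

lemma legal_toppling_shortens:
  assumes "(legal_toppling L ^^ n) \<zeta> \<xi>" "\<xi> \<in> stable_sandpiles L" "legal_toppling L \<zeta> \<zeta>'"
  shows "\<exists>k. n = Suc k \<and> (legal_toppling L ^^ k) \<zeta>' \<xi>"
  using assms
proof (induction n arbitrary: \<zeta> \<zeta>')
  case 0
  then show ?case using stable_no_toppling[of \<zeta> L \<zeta>'] by simp
next
  case (Suc n)
  obtain \<zeta>1 where 1: "legal_toppling L \<zeta> \<zeta>1" "(legal_toppling L ^^ n) \<zeta>1 \<xi>"
    using relpowp_Suc_D2[OF Suc.prems(1)] by auto
  show ?case
  proof (cases "\<zeta>1 = \<zeta>'")
    case True
    then show ?thesis using 1 by auto
  next
    case False
    then obtain \<zeta>2 where 2: "legal_toppling L \<zeta>1 \<zeta>2" "legal_toppling L \<zeta>' \<zeta>2"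
      using legal_toppling_diamond[OF 1(1) Suc.prems(3)] by auto
    then obtain k where "n = Suc k" "(legal_toppling L ^^ k) \<zeta>2 \<xi>"
      using Suc.IH[OF 1(2) Suc.prems(2)] by auto
    then show ?thesis using relpowp_Suc_I2[of "legal_toppling L", OF 2(2)] by auto
  qed
qed

lemma stabilization_length_unique:
  assumes "(legal_toppling L ^^ n) \<zeta> \<xi>" "\<xi> \<in> stable_sandpiles L"
    and "(legal_toppling L ^^ n') \<zeta> \<xi>'" "\<xi>' \<in> stable_sandpiles L"
  shows "n = n'"
  using assms
proof (induction n arbitrary: \<zeta> n')
  case 0
  then have "\<not> legal_toppling L \<zeta> \<zeta>'" for \<zeta>'
    using stable_no_toppling[of \<zeta> L \<zeta>'] by simp
  then show ?case using 0(3) by (cases n') (auto simp del: relpowp.simps dest: relpowp_Suc_D2)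
next
  case (Suc n)
  obtain \<zeta>1 where 1: "legal_toppling L \<zeta> \<zeta>1" "(legal_toppling L ^^ n) \<zeta>1 \<xi>"
    using relpowp_Suc_D2[OF Suc.prems(1)] by auto
  then obtain k where "n' = Suc k" "(legal_toppling L ^^ k) \<zeta>1 \<xi>'"
    using legal_toppling_shortens[OF Suc.prems(3,4)] by auto
  then show ?case using Suc.IH[OF 1(2) Suc.prems(2) _ Suc.prems(4)] by auto
qed

lemma legal_toppling_nonneg:
  assumes "(legal_toppling L ^^ n) \<zeta> \<xi>" "\<forall>w\<in>box L. 0 \<le> \<zeta> w"
  shows "\<forall>w\<in>box L. 0 \<le> \<xi> w"
  using assms
proof (induction n arbitrary: \<xi>)
  case (Suc n)
  then obtain \<zeta>1 where "(legal_toppling L ^^ n) \<zeta> \<zeta>1" "legal_toppling L \<zeta>1 \<xi>" by auto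
  then show ?case using Suc by (force simp: legal_toppling_def topple_def)
qed simp

text \<open>
The means by which avalanche sizes are computed: an odometer that is legal and leaves no vertex
unstable is the odometer of the avalanche.
\<close>

lemma avalanche_size_eq:
  assumes leg: "legal_firing L (add_grain v \<eta>) m"
    and nonneg: "\<And>w. w \<in> box L \<Longrightarrow> 0 \<le> \<eta> w"
    and settled: "\<And>w. w \<in> box L \<Longrightarrow> add_grain v \<eta> w + lap m w \<le> 3"
  shows "int (avalanche_size L \<eta> v) = (\<Sum>w\<in>box L. m w)"
proof -
  let ?n = "nat (\<Sum>w\<in>box L. m w)" and ?\<xi> = "fire L m (add_grain v \<eta>)"
  have reach: "(legal_toppling L ^^ ?n) (add_grain v \<eta>) ?\<xi>"
    using leg by (simp add: legal_firing_def)
  have "\<forall>w\<in>box L. 0 \<le> ?\<xi> w"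
    using legal_toppling_nonneg[OF reach] nonneg by (auto simp: add_grain_def add_nonneg_nonneg)
  then have stab: "?\<xi> \<in> stable_sandpiles L"
    using settled by (force simp: stable_sandpiles_def fire_def)
  have "avalanche_size L \<eta> v = ?n"
    unfolding avalanche_size_def
    using reach stab stabilization_length_unique by (intro the_equality) blast+
  moreover have "0 \<le> (\<Sum>w\<in>box L. m w)"
    using leg by (intro sum_nonneg) (auto simp: legal_firing_def)
  ultimately show ?thesis by simp
qed

section \<open>Concentric squares\<close>

lemma int_interval_const:
  fixes g :: "int \<Rightarrow> 'b"
  assumes step: "\<And>i. lo \<le> i \<Longrightarrow> i + 1 < hi \<Longrightarrow> g i = g (i + 1)"
    and "i \<in> {lo..<hi}" "j \<in> {lo..<hi}"
  shows "g i = g j"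
proof -
  have *: "g lo = g k" if "lo \<le> k" "k < hi" for k
    using that by (induction k rule: int_ge_induct) (auto dest: step)
  show ?thesis using *[of i] *[of j] assms(2,3) by simp
qed

text \<open>
Every row and every column that avoids \<open>p\<close> is an interval, hence connected, and every row meets
every column. A vertex other than \<open>p\<close> lies in a row or a column that avoids \<open>p\<close>, so all vertices
can be compared with the crossing \<open>(x0, y0)\<close> of one such column and one such row. The vertex \<open>p\<close>
may lie outside the square, in which case nothing is removed.
\<close>

lemma punctured_square_connected:
  fixes f :: "vertex \<Rightarrow> bool"
  assumes X: "X = {a..<c} \<times> {b..<d} - {p}" and sides: "c - a = d - b"
    and const: "\<And>y z. y \<in> X \<Longrightarrow> z \<in> X \<Longrightarrow> adj y z \<Longrightarrow> f y = f z"
    and q: "q \<in> X" and r: "r \<in> X"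
  shows "f q = f r"
proof (cases "c - a \<le> 1")
  case True
  then have "q = r" using q r sides unfolding X by (cases q; cases r) auto
  then show ?thesis by simp
next
  case False
  have col: "f (x, y) = f (x, y')"
    if "x \<in> {a..<c}" "x \<noteq> fst p" "y \<in> {b..<d}" "y' \<in> {b..<d}" for x y y'
  proof (rule int_interval_const[of b d "\<lambda>y. f (x, y)"])
    fix i assume "b \<le> i" "i + 1 < d"
    then show "f (x, i) = f (x, i + 1)"
      using that by (intro const) (auto simp: X adj_def)
  qed (use that in auto)
  have row: "f (x, y) = f (x', y)"
    if "y \<in> {b..<d}" "y \<noteq> snd p" "x \<in> {a..<c}" "x' \<in> {a..<c}" for x x' y
  proof (rule int_interval_const[of a c "\<lambda>x. f (x, y)"])
    fix i assume "a \<le> i" "i + 1 < c"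
    then show "f (i, y) = f (i + 1, y)"
      using that by (intro const) (auto simp: X adj_def)
  qed (use that in auto)
  obtain x0 where x0: "x0 \<in> {a..<c}" "x0 \<noteq> fst p"
    by (rule that[of "if fst p = a then a + 1 else a"]) (use False in auto)
  obtain y0 where y0: "y0 \<in> {b..<d}" "y0 \<noteq> snd p"
    by (rule that[of "if snd p = b then b + 1 else b"]) (use False sides in auto)
  have "f w = f (x0, y0)" if w: "w \<in> X" for w
  proof -
    obtain x y where xy: "w = (x, y)" by fastforce
    have mem: "x \<in> {a..<c}" "y \<in> {b..<d}" and "(x, y) \<noteq> p" using w by (auto simp: X xy)
    then consider "x \<noteq> fst p" | "y \<noteq> snd p" by (cases p) auto
    then show ?thesis
    proof cases
      case 1
      then show ?thesis using col[OF mem(1) 1 mem(2) y0(1)] row[OF y0 mem(1) x0(1)] xy by simp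
    next
      case 2
      then show ?thesis using row[OF mem(2) 2 mem(1) x0(1)] col[OF x0 mem(2) y0(1)] xy by simp
    qed
  qed
  then show ?thesis using q r by metis
qed

text \<open>
The square with lower left vertex \<open>(a, b)\<close> and side \<open>n\<close>.
\<close>

locale lattice_square =
  fixes a b n :: int
begin

text \<open>
The number of the layer of the square that contains \<open>w\<close>, counted from 1 at the boundary inwards;
it is 0 exactly outside the square. Each affine function below is the distance to one of the
four side lines that surround the square.
\<close>

definition depth :: "vertex \<Rightarrow> int" where
  "depth w = max 0 (min (min (fst w - a + 1) (a + n - fst w)) (min (snd w - b + 1) (b + n - snd w)))"

text \<open>
The odometer of the first \<open>k\<close> waves, the wave of number \<open>j\<close> (from 0) toppling the vertices of
depth more than \<open>j\<close> once each.
\<close>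

definition odometer :: "int \<Rightarrow> vertex \<Rightarrow> int" where
  "odometer k w = min (depth w) k"

text \<open>
On a layer whose square has side at least 3, this singles out the vertices that are not corners;
on an innermost layer, of side 1 or 2, no vertex has an inner neighbour.
\<close>

definition has_inner_neighbour :: "vertex \<Rightarrow> bool" where
  "has_inner_neighbour w \<longleftrightarrow> (\<exists>u. adj w u \<and> depth u = depth w + 1)"

lemma depth_nonneg: "0 \<le> depth w"
  by (simp add: depth_def)

lemma depth_gt_region:
  assumes "0 \<le> k"
  shows "{w. k < depth w} = {a + k..<a + n - k} \<times> {b + k..<b + n - k}"
  using assms by (auto simp: depth_def)

lemma depth_ge_iff:
  assumes "1 \<le> k"
  shows "k \<le> depth w \<longleftrightarrow>
    a + k - 1 \<le> fst w \<and> fst w \<le> a + n - k \<and> b + k - 1 \<le> snd w \<and> snd w \<le> b + n - k"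
  using assms by (auto simp: depth_def)

lemma depth_adj:
  assumes "adj w z"
  shows "\<bar>depth w - depth z\<bar> \<le> 1"
proof -
  have *: "depth y - 1 \<le> depth x" if "adj x y" for x y
  proof (cases "depth y \<le> 1")
    case True
    then show ?thesis using depth_nonneg[of x] by simp
  next
    case False
    then have k: "1 \<le> depth y" "1 \<le> depth y - 1" by auto
    have "depth y \<le> depth y" by simp
    then show ?thesis using that unfolding depth_ge_iff[OF k(1)] depth_ge_iff[OF k(2)] adj_iff by auto
  qed
  show ?thesis using *[OF assms] *[of z w] assms adj_sym[of w z] by auto
qed

text \<open>
If all four neighbours of \<open>w\<close> lay in the concentric square through \<open>w\<close>, then \<open>w\<close> would lie one
layer further inside.
\<close>

lemma outer_neighbour:
  assumes w: "1 \<le> depth w" shows "\<exists>z. adj w z \<and> depth z = depth w - 1"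
proof (rule ccontr)
  define k where "k = depth w"
  have k: "1 \<le> k" and k': "1 \<le> k + 1" using w by (auto simp: k_def)
  assume no: "\<not> ?thesis"
  have "k \<le> depth z" if "adj w z" for z
  proof -
    have "depth z \<noteq> k - 1" using no that unfolding k_def by blast
    then show ?thesis using depth_adj[OF that] by (simp add: k_def)
  qed
  then have "k \<le> depth (fst w + 1, snd w)" "k \<le> depth (fst w - 1, snd w)"
    "k \<le> depth (fst w, snd w + 1)" "k \<le> depth (fst w, snd w - 1)"
    by (auto simp: adj_iff)
  then have "k + 1 \<le> depth w"
    unfolding depth_ge_iff[OF k] depth_ge_iff[OF k'] by auto
  then show False by (simp add: k_def)
qed

lemma inner_neighbour_unique:
  assumes "adj w z" "adj w z'" "depth z = depth w + 1" "depth z' = depth w + 1"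
  shows "z = z'"
proof -
  define k where "k = depth w + 1"
  have k: "1 \<le> k" using depth_nonneg[of w] by (simp add: k_def)
  have "k \<le> depth z" "k \<le> depth z'" "\<not> k \<le> depth w" using assms by (auto simp: k_def)
  then show ?thesis using assms(1,2) unfolding depth_ge_iff[OF k] adj_iff by auto
qed

text \<open>
If \<open>w\<close> has an inner neighbour, its only outer neighbour is the opposite one, the reflection of
\<open>u\<close> in \<open>w\<close>.
\<close>

lemma opposite_outer_unique:
  assumes "1 \<le> depth w" "adj w u" "depth u = depth w + 1"
    and "adj w z" "adj w z'" "depth z = depth w - 1" "depth z' = depth w - 1"
  shows "z = z'"
proof -
  define k where "k = depth w"
  have k: "1 \<le> k" and k': "1 \<le> k + 1" using assms(1) by (auto simp: k_def)
  have u: "k + 1 \<le> depth u" and w: "k \<le> depth w" using assms by (auto simp: k_def)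
  have "y = (2 * fst w - fst u, 2 * snd w - snd u)" if "adj w y" "depth y = depth w - 1" for y
  proof -
    have "\<not> k \<le> depth y" using that by (simp add: k_def)
    then show ?thesis
      using u w assms(2) that(1) unfolding depth_ge_iff[OF k] depth_ge_iff[OF k'] adj_iff by auto
  qed
  then show ?thesis using assms(4-7) by metis
qed

text \<open>
A vertex \<open>u\<close> of a square of side at least 2 has two neighbours in this square, one in each
direction of the axes. That the side is at least 2 is witnessed by the second vertex \<open>v\<close>.
\<close>

lemma two_neighbours_in_region:
  assumes "1 \<le> depth u" "depth u \<le> depth v" "v \<noteq> u"
  shows "2 \<le> lap (\<lambda>w. of_bool (depth u \<le> depth w \<and> w \<noteq> u)) u"
proof -
  obtain x y where u: "u = (x, y)" by fastforce
  obtain x' y' where v: "v = (x', y')" by fastforce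
  define k where "k = depth u"
  have k: "1 \<le> k" using assms(1) by (auto simp: k_def)
  have "k \<le> depth u" "k \<le> depth v" using assms by (auto simp: k_def)
  then have in_box: "a + k - 1 \<le> x" "x \<le> a + n - k" "b + k - 1 \<le> y" "y \<le> b + n - k"
    and "a + k - 1 \<le> x'" "x' \<le> a + n - k" "b + k - 1 \<le> y'" "y' \<le> b + n - k"
    unfolding depth_ge_iff[OF k] by (auto simp: u v)
  moreover have "x \<noteq> x' \<or> y \<noteq> y'" using assms(3) by (auto simp: u v)
  ultimately have "a + k - 1 < a + n - k" by linarith
  with in_box have "k \<le> depth (x + 1, y) \<or> k \<le> depth (x - 1, y)"
    "k \<le> depth (x, y + 1) \<or> k \<le> depth (x, y - 1)"
    unfolding depth_ge_iff[OF k] by auto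
  then show ?thesis
    unfolding lap_def k_def[symmetric] by (auto simp: u)
qed

lemma odometer_step: "odometer k w + of_bool (k < depth w) = odometer (k + 1) w"
  by (auto simp: odometer_def)

lemma lap_diff: "lap (\<lambda>w. f w - g w) v = lap f v - lap g v"
  by (simp add: lap_def algebra_simps)

lemma lap_odometer_interior:
  assumes "k < depth w"
  shows "lap (odometer k) w = 0"
proof -
  have *: "k \<le> depth z" if "adj w z" for z
    using depth_adj[OF that] assms by linarith
  show ?thesis using assms by (simp add: lap_def odometer_def * adj_iff min_absorb2)
qed

text \<open>
How the first \<open>k\<close> waves change the heights. On the square \<open>depth\<close> is a minimum of affine functions,
so it is superharmonic there and heights do not grow; they drop strictly on the layer where the
waves stop, and at corners. Outside the square a height grows by at most the one grain from the
only neighbour in the square. All bounds follow from the following facts on the depths \<open>d i\<close> of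
the four neighbours: they differ by at most one from the depth of \<open>w\<close>, at most one is larger, at
least one is smaller, and exactly one is smaller if one is larger.
\<close>

lemma lap_odometer_bounds:
  assumes "0 \<le> k"
  shows "1 \<le> depth w \<Longrightarrow> lap (odometer k) w \<le> 0"
    and "1 \<le> depth w \<Longrightarrow> depth w = k \<Longrightarrow> lap (odometer k) w \<le> - 1"
    and "1 \<le> depth w \<Longrightarrow> depth w \<le> k \<Longrightarrow> \<not> has_inner_neighbour w \<Longrightarrow> lap (odometer k) w \<le> - 1"
    and "depth w = 0 \<Longrightarrow> lap (odometer k) w \<le> 1"
    and "depth w = 0 \<Longrightarrow> \<not> (\<exists>z. adj w z \<and> 1 \<le> depth z) \<Longrightarrow> lap (odometer k) w \<le> 0"
    and "1 \<le> depth w \<Longrightarrow> depth w = k \<Longrightarrow> has_inner_neighbour w \<Longrightarrow> - 1 \<le> lap (odometer k) w"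
proof -
  note One_nat_def [simp del]
  define e where "e = (\<lambda>i::nat. [(fst w + 1, snd w), (fst w - 1, snd w), (fst w, snd w + 1), (fst w, snd w - 1)] ! i)"
  define d where "d i = depth (e i)" for i
  have e: "e 0 = (fst w + 1, snd w)" "e 1 = (fst w - 1, snd w)" "e 2 = (fst w, snd w + 1)" "e 3 = (fst w, snd w - 1)"
    by (simp_all add: e_def numeral_3_eq_3)
  have ex: "adj w z \<longleftrightarrow> z = e 0 \<or> z = e 1 \<or> z = e 2 \<or> z = e 3" for z
    unfolding adj_iff e by auto
  have dist: "e i \<noteq> e j" if "i < j" "j < 4" for i j
  proof -
    have "j = 1 \<or> j = 2 \<or> j = 3" "i = 0 \<or> i = 1 \<or> i = 2" using that by auto
    then show ?thesis using that e by auto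
  qed
  have adj: "adj w (e i)" if "i < 4" for i
  proof -
    have "i = 0 \<or> i = 1 \<or> i = 2 \<or> i = 3" using that by auto
    then show ?thesis using ex by auto
  qed
  have near: "\<bar>d i - depth w\<bar> \<le> 1" if "i < 4" for i
    using depth_adj[OF adj[OF that]] by (simp add: d_def abs_minus_commute)
  have one_in: "d i \<le> depth w \<or> d j \<le> depth w" if "i < j" "j < 4" for i j
  proof (rule ccontr)
    assume "\<not> ?thesis"
    then have "d i = depth w + 1" "d j = depth w + 1" using near[of i] near[of j] that by auto
    then show False
      using inner_neighbour_unique[OF adj adj, of i j] dist[OF that] that by (simp add: d_def)
  qed
  have one_out: "depth w \<le> d i \<or> depth w \<le> d j"
    if ij: "i < j" "j < 4" and w: "1 \<le> depth w" and in_nb: "has_inner_neighbour w" for i j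
  proof (rule ccontr)
    assume "\<not> ?thesis"
    then have out: "d i = depth w - 1" "d j = depth w - 1" using near[of i] near[of j] ij by auto
    obtain u where "adj w u" "depth u = depth w + 1"
      using in_nb by (auto simp: has_inner_neighbour_def)
    from opposite_outer_unique[OF w this adj adj, of i j] show False
      using out dist[OF ij] ij by (simp add: d_def)
  qed
  have some_out: "d 0 = depth w - 1 \<or> d 1 = depth w - 1 \<or> d 2 = depth w - 1 \<or> d 3 = depth w - 1"
    if "1 \<le> depth w"
    using outer_neighbour[OF that] unfolding ex d_def by auto
  have lap: "lap (odometer k) w = min (d 0) k + min (d 1) k + min (d 2) k + min (d 3) k - 4 * min (depth w) k"
    unfolding lap_def odometer_def d_def e ..
  note nr = near[of 0, simplified] near[of 1, simplified] near[of 2, simplified] near[of 3, simplified]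
  note oi = one_in[of 0 1, simplified] one_in[of 0 2, simplified] one_in[of 0 3, simplified]
    one_in[of 1 2, simplified] one_in[of 1 3, simplified] one_in[of 2 3, simplified]
  have three_not_in:
      "d 1 \<le> depth w \<and> d 2 \<le> depth w \<and> d 3 \<le> depth w \<or>
       d 0 \<le> depth w \<and> d 2 \<le> depth w \<and> d 3 \<le> depth w \<or>
       d 0 \<le> depth w \<and> d 1 \<le> depth w \<and> d 3 \<le> depth w \<or>
       d 0 \<le> depth w \<and> d 1 \<le> depth w \<and> d 2 \<le> depth w"
    using oi by blast
  have three_not_out:
      "d 1 \<ge> depth w \<and> d 2 \<ge> depth w \<and> d 3 \<ge> depth w \<or>
       d 0 \<ge> depth w \<and> d 2 \<ge> depth w \<and> d 3 \<ge> depth w \<or>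
       d 0 \<ge> depth w \<and> d 1 \<ge> depth w \<and> d 3 \<ge> depth w \<or>
       d 0 \<ge> depth w \<and> d 1 \<ge> depth w \<and> d 2 \<ge> depth w"
    if that: "1 \<le> depth w" "has_inner_neighbour w"
  proof -
    note oo = one_out[OF _ _ that]
    have "depth w \<le> d 0 \<or> depth w \<le> d 1" "depth w \<le> d 0 \<or> depth w \<le> d 2"
      "depth w \<le> d 0 \<or> depth w \<le> d 3" "depth w \<le> d 1 \<or> depth w \<le> d 2"
      "depth w \<le> d 1 \<or> depth w \<le> d 3" "depth w \<le> d 2 \<or> depth w \<le> d 3"
      by (rule oo; simp)+
    then show ?thesis by blast
  qed
  have min_le: "min (d i) k \<le> d i" "min (d i) k \<le> k" for i by auto
  note ml = min_le[of 0] min_le[of 1] min_le[of 2] min_le[of 3]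
  show "lap (odometer k) w \<le> 0" if "1 \<le> depth w"
  proof (cases "k \<le> depth w")
    case True
    then show ?thesis using ml unfolding lap by (simp add: min_absorb2)
  next
    case False
    have "d 0 + d 1 + d 2 + d 3 \<le> 4 * depth w"
      using three_not_in some_out[OF that] nr by (elim disjE conjE) linarith+
    then show ?thesis using ml False unfolding lap by (simp add: min_absorb1)
  qed
  show "lap (odometer k) w \<le> - 1" if "1 \<le> depth w" "depth w = k"
  proof -
    have "min (depth w) k = k" using that(2) by simp
    then show ?thesis using some_out[OF that(1)] that(2) ml unfolding lap by (elim disjE) linarith+
  qed
  show "lap (odometer k) w \<le> - 1" if "1 \<le> depth w" "depth w \<le> k" and no: "\<not> has_inner_neighbour w"
  proof -
    have "d i \<le> depth w" if "i < 4" for i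
    proof -
      have "d i \<noteq> depth w + 1" using no adj[OF that] unfolding d_def has_inner_neighbour_def by blast
      then show ?thesis using near[OF that] by linarith
    qed
    then have "d 0 \<le> depth w" "d 1 \<le> depth w" "d 2 \<le> depth w" "d 3 \<le> depth w" by simp_all
    then have "d 0 + d 1 + d 2 + d 3 \<le> 4 * depth w - 1"
      using some_out[OF that(1)] by (elim disjE) linarith+
    then show ?thesis using ml that(2) unfolding lap by (simp add: min_absorb1)
  qed
  show "lap (odometer k) w \<le> 1" if "depth w = 0"
  proof -
    have "d 0 + d 1 + d 2 + d 3 \<le> 1"
      using three_not_in nr that by (elim disjE conjE) linarith+
    then show ?thesis using ml that assms unfolding lap by simp
  qed
  show "lap (odometer k) w \<le> 0" if "depth w = 0" and no: "\<not> (\<exists>z. adj w z \<and> 1 \<le> depth z)"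
  proof -
    have "d i \<le> 0" if "i < 4" for i
    proof -
      have "\<not> 1 \<le> d i" using no adj[OF that] unfolding d_def by blast
      then show ?thesis by linarith
    qed
    then have "d 0 \<le> 0" "d 1 \<le> 0" "d 2 \<le> 0" "d 3 \<le> 0" by simp_all
    then show ?thesis using ml that(1) assms unfolding lap by simp
  qed
  show "- 1 \<le> lap (odometer k) w" if "1 \<le> depth w" "depth w = k" "has_inner_neighbour w"
    using three_not_out[OF that(1,3)] nr that(2) unfolding lap min_def by (elim disjE conjE) auto
qed

lemma punctured_region_cut:
  assumes "0 \<le> k" and S: "S \<subset> {w. k < depth w \<and> w \<noteq> q}" "S \<noteq> {}"
  shows "\<exists>y\<in>S. \<exists>z\<in>{w. k < depth w \<and> w \<noteq> q} - S. adj y z"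
proof (rule ccontr)
  let ?X = "{w. k < depth w \<and> w \<noteq> q}"
  assume no: "\<not> ?thesis"
  have X: "?X = {a + k..<a + n - k} \<times> {b + k..<b + n - k} - {q}"
    using depth_gt_region[OF assms(1)] by blast
  have const: "(y \<in> S) = (z \<in> S)" if "y \<in> ?X" "z \<in> ?X" "adj y z" for y z
    using no that adj_sym[of y z] by blast
  obtain y z where y: "y \<in> S" and z: "z \<in> ?X" "z \<notin> S" using S by blast
  have "(y \<in> S) = (z \<in> S)"
    by (rule punctured_square_connected[OF X _ const]) (use S y z in auto)
  then show False using y z by simp
qed

lemma lap_odometer_minus_vertex:
  "lap (\<lambda>w. odometer k w - of_bool (w = p)) z = lap (odometer k) z - of_bool (adj p z) + 4 * of_bool (z = p)"
  by (simp add: lap_diff lap_of_bool_eq)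

end

section \<open>Waves in a square generator\<close>

text \<open>
All that is used of a square generator. The last assumption is the maximality of the generator:
a critical vertex next to the square would belong to it.
\<close>

locale square_generator = lattice_square a b n for a b n :: int +
  fixes L :: nat and \<eta> :: sandpile
  assumes in_box: "1 \<le> depth w \<Longrightarrow> w \<in> box L"
    and stable: "w \<in> box L \<Longrightarrow> 0 \<le> \<eta> w \<and> \<eta> w \<le> 3"
    and critical: "1 \<le> depth w \<Longrightarrow> \<eta> w = 3"
    and surrounded: "w \<in> box L \<Longrightarrow> depth w = 0 \<Longrightarrow> adj w z \<Longrightarrow> 1 \<le> depth z \<Longrightarrow> \<eta> w \<le> 2"
begin

text \<open>
A wave over a concentric square, or over such a square without one vertex \<open>q\<close>. The hypothesis on
\<open>lap m\<close> says that the topplings made before have given back to each vertex what they took.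
\<close>

lemma wave:
  assumes m: "legal_firing L \<zeta> m" and k: "0 \<le> k"
    and flat: "\<And>w. k < depth w \<Longrightarrow> w \<noteq> q \<Longrightarrow> lap m w = 0"
    and crit: "\<And>w. k < depth w \<Longrightarrow> w \<noteq> q \<Longrightarrow> 3 \<le> \<zeta> w"
    and v: "k < depth v" "v \<noteq> q" "3 < \<zeta> v"
  shows "legal_firing L \<zeta> (\<lambda>w. m w + of_bool (k < depth w \<and> w \<noteq> q))"
proof -
  have box: "w \<in> box L" if "k < depth w" for w using in_box[of w] that k by simp
  have fire: "fire L m \<zeta> w = \<zeta> w" if "k < depth w" "w \<noteq> q" for w
    using flat[OF that] box[OF that(1)] by (simp add: fire_def)
  have "legal_firing L \<zeta> (\<lambda>w. m w + of_bool (w \<in> {w. k < depth w \<and> w \<noteq> q}))"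
    by (rule legal_firing_connected[OF m, of _ v])
      (use punctured_region_cut[OF k] box fire crit v in auto)
  then show ?thesis by simp
qed

text \<open>
As long as the pit \<open>p\<close>, an emptied vertex, is interior to the square of the wave, it receives
four grains from its neighbours and topples last, so that the wave is complete and the pit is
empty again. Letting \<open>p\<close> lie outside the square (\<open>depth p = 0\<close>) covers the sandpile without a
pit.
\<close>

lemma waves_outside_pit:
  assumes crit: "\<And>w. 1 \<le> depth w \<Longrightarrow> w \<noteq> p \<Longrightarrow> 3 \<le> \<zeta> w"
    and pit: "1 \<le> depth p \<Longrightarrow> 0 \<le> \<zeta> p"
    and v: "3 < \<zeta> v" "v \<noteq> p"
    and k: "0 \<le> k" "k \<le> depth v" "k < depth p \<or> depth p = 0"
  shows "legal_firing L \<zeta> (odometer k)"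
  using k
proof (induction k rule: int_ge_induct)
  case base
  have "odometer 0 = (\<lambda>w. 0)" using depth_nonneg by (auto simp: odometer_def fun_eq_iff)
  then show ?case using legal_firing_zero by simp
next
  case (step k)
  let ?m = "\<lambda>w. odometer k w + of_bool (k < depth w \<and> w \<noteq> p)"
  have prev: "legal_firing L \<zeta> (odometer k)" using step by auto
  have m: "legal_firing L \<zeta> ?m"
    by (rule wave[OF prev, of _ _ v]) (use step crit v lap_odometer_interior in auto)
  show ?case
  proof (cases "k < depth p")
    case False
    then have "?m = odometer (k + 1)" by (auto simp: fun_eq_iff odometer_def)
    then show ?thesis using m by simp
  next
    case True
    then have p: "k + 1 < depth p" "p \<in> box L" using step in_box[of p] by auto
    have "k < depth z" if "adj p z" for z using depth_adj[OF that] p by linarith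
    then have "lap (\<lambda>w. of_bool (k < depth w \<and> w \<noteq> p)) p = 4"
      by (cases p) (simp add: lap_def adj_iff)
    then have "fire L ?m \<zeta> p = \<zeta> p + 4"
      using p lap_odometer_interior[of k p] by (simp add: fire_def lap_add)
    then have "legal_firing L \<zeta> (\<lambda>w. ?m w + of_bool (w = p))"
      using legal_firing_vertex[OF m p(2)] pit p step(1) by simp
    moreover have "(\<lambda>w. ?m w + of_bool (w = p)) = odometer (k + 1)"
      using True by (auto simp: fun_eq_iff odometer_def)
    ultimately show ?thesis by simp
  qed
qed

text \<open>
The wave in which the pit lies on the boundary of the square: it receives at most three grains
and does not topple.
\<close>

lemma wave_around_pit:
  assumes crit: "\<And>w. 1 \<le> depth w \<Longrightarrow> w \<noteq> p \<Longrightarrow> 3 \<le> \<zeta> w" and pit: "0 \<le> \<zeta> p"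
    and v: "3 < \<zeta> v" "v \<noteq> p" and p: "1 \<le> depth p" "depth p \<le> depth v"
  shows "legal_firing L \<zeta> (\<lambda>w. odometer (depth p) w - of_bool (w = p))"
proof -
  define k where "k = depth p - 1"
  have k: "0 \<le> k" "k < depth v" "depth p = k + 1" using p by (auto simp: k_def)
  have prev: "legal_firing L \<zeta> (odometer k)"
    by (rule waves_outside_pit[OF crit pit v]) (use k in auto)
  have "legal_firing L \<zeta> (\<lambda>w. odometer k w + of_bool (k < depth w \<and> w \<noteq> p))"
    by (rule wave[OF prev k(1), of _ v]) (use k crit v lap_odometer_interior in auto)
  moreover have "(\<lambda>w. odometer k w + of_bool (k < depth w \<and> w \<noteq> p)) = (\<lambda>w. odometer (depth p) w - of_bool (w = p))"
    using k by (auto simp: fun_eq_iff odometer_def)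
  ultimately show ?thesis by simp
qed

text \<open>
A corner of its square has no neighbour inside the later, smaller squares, so their waves are not
affected by the missing toppling.
\<close>

lemma waves_after_corner_pit:
  assumes crit: "\<And>w. 1 \<le> depth w \<Longrightarrow> w \<noteq> p \<Longrightarrow> 3 \<le> \<zeta> w" and pit: "0 \<le> \<zeta> p"
    and v: "3 < \<zeta> v" "v \<noteq> p" and p: "1 \<le> depth p"
    and corner: "\<not> has_inner_neighbour p"
    and k: "depth p \<le> k" "k \<le> depth v"
  shows "legal_firing L \<zeta> (\<lambda>w. odometer k w - of_bool (w = p))"
  using k
proof (induction k rule: int_ge_induct)
  case base
  then show ?case using wave_around_pit[OF crit pit v p] by simp
next
  case (step k)
  let ?m = "\<lambda>w. odometer k w - of_bool (w = p)"
  have prev: "legal_firing L \<zeta> ?m" using step by simp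
  have flat: "lap ?m w = 0" if "k < depth w" for w
  proof -
    have "\<not> adj p w"
    proof
      assume "adj p w"
      then have "depth w = depth p + 1" using depth_adj[of p w] that step by linarith
      then show False using corner \<open>adj p w\<close> unfolding has_inner_neighbour_def by blast
    qed
    moreover have "w \<noteq> p" using that step by auto
    ultimately show ?thesis using that by (simp add: lap_odometer_minus_vertex lap_odometer_interior)
  qed
  have "legal_firing L \<zeta> (\<lambda>w. ?m w + of_bool (k < depth w \<and> w \<noteq> p))"
    by (rule wave[OF prev, of _ _ v]) (use step crit v flat p in auto)
  moreover have "(\<lambda>w. ?m w + of_bool (k < depth w \<and> w \<noteq> p)) = (\<lambda>w. odometer (k + 1) w - of_bool (w = p))"
    using step by (auto simp: fun_eq_iff odometer_def)
  ultimately show ?case by simp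
qed

text \<open>
If \<open>p\<close> has an inner neighbour \<open>u\<close>, the missing toppling of \<open>p\<close> leaves the height of \<open>u\<close> one lower.
When the grain has not landed at \<open>u\<close>, the next wave still reaches \<open>u\<close>: it has at least two
neighbours in the smaller square, which lift its height from 2 to 4. At this time \<open>p\<close> holds three
grains, and the toppling of \<open>u\<close> supplies the fourth. So \<open>p\<close> makes up for its missing toppling with
a delay of one wave, and the avalanche continues as if nothing had been removed.
\<close>

lemma waves_after_edge_pit:
  assumes crit: "\<And>w. 1 \<le> depth w \<Longrightarrow> w \<noteq> p \<Longrightarrow> 3 \<le> \<zeta> w" and pit: "0 \<le> \<zeta> p"
    and v: "3 < \<zeta> v" "v \<noteq> p" "v \<noteq> u" and p: "1 \<le> depth p"
    and u: "adj p u" "depth u = depth p + 1"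
    and k: "depth p + 1 \<le> k" "k \<le> depth v"
  shows "legal_firing L \<zeta> (odometer k)"
  using k
proof (induction k rule: int_ge_induct)
  case base
  define d where "d = depth p"
  let ?m = "\<lambda>w. odometer d w - of_bool (w = p)"
  let ?X = "\<lambda>w. of_bool (d < depth w \<and> w \<noteq> u) :: int"
  have ne: "u \<noteq> p" using u by auto
  have pbox: "p \<in> box L" and ubox: "u \<in> box L" using p u in_box[of p] in_box[of u] by auto
  have m: "legal_firing L \<zeta> ?m"
    unfolding d_def by (rule wave_around_pit[OF crit pit v(1,2) p]) (use base in auto)
  have lap_m: "lap ?m w = - of_bool (adj p w)" if "d < depth w" for w
    using that lap_odometer_interior[of d w] by (auto simp: lap_odometer_minus_vertex d_def)
  have flat: "lap ?m w = 0" if "d < depth w" "w \<noteq> u" for w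
  proof -
    have "\<not> adj p w"
    proof
      assume "adj p w"
      then have "depth w = depth p + 1" using depth_adj[of p w] that by (simp add: d_def)
      then show False using inner_neighbour_unique[OF \<open>adj p w\<close> u(1)] u that by simp
    qed
    then show ?thesis using lap_m[OF that(1)] by simp
  qed
  \<comment> \<open>the wave without \<open>u\<close>, and then \<open>u\<close> and \<open>p\<close> separately\<close>
  have m1: "legal_firing L \<zeta> (\<lambda>w. ?m w + ?X w)"
  proof (rule wave[OF m, of _ _ v])
    show "3 \<le> \<zeta> w" if "d < depth w" for w
      using crit[of w] that p by (auto simp: d_def)
  qed (use base v flat p in \<open>auto simp: d_def\<close>)
  have "depth u \<le> depth w \<longleftrightarrow> d < depth w" for w using u by (auto simp: d_def)
  then have "2 \<le> lap ?X u"
    using two_neighbours_in_region[of u v] u p v base by simp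
  moreover have "lap ?m u = - 1" using lap_m[of u] u by (simp add: d_def)
  moreover have "3 \<le> \<zeta> u" using crit[of u] u p ne by simp
  ultimately have "3 < fire L (\<lambda>w. ?m w + ?X w) \<zeta> u"
    using ubox unfolding fire_def lap_add by simp
  then have m2: "legal_firing L \<zeta> (\<lambda>w. ?m w + ?X w + of_bool (w = u))"
    using legal_firing_vertex[OF m1 ubox] by simp
  have "- 1 \<le> lap (odometer d) p"
  proof -
    have "has_inner_neighbour p" using u unfolding has_inner_neighbour_def by blast
    from lap_odometer_bounds(6)[OF _ p refl this] show ?thesis using p unfolding d_def by linarith
  qed
  then have "3 \<le> lap ?m p" using p by (simp add: lap_odometer_minus_vertex adj_def)
  moreover have "0 \<le> lap ?X p"
    using lap_of_bool_ge(1)[of p "{w. d < depth w \<and> w \<noteq> u}"] by (simp add: d_def)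
  moreover have "lap (\<lambda>w. of_bool (w = u)) p = 1"
    using u ne adj_sym[of p u] by (simp add: lap_of_bool_eq)
  ultimately have "3 < fire L (\<lambda>w. ?m w + ?X w + of_bool (w = u)) \<zeta> p"
    using pbox pit unfolding fire_def lap_add by simp
  then have "legal_firing L \<zeta> (\<lambda>w. ?m w + ?X w + of_bool (w = u) + of_bool (w = p))"
    using legal_firing_vertex[OF m2 pbox] by simp
  moreover have "(\<lambda>w. ?m w + ?X w + of_bool (w = u) + of_bool (w = p)) = odometer (depth p + 1)"
    using u ne by (auto simp: fun_eq_iff odometer_def d_def)
  ultimately show ?case by simp
next
  case (step k)
  have prev: "legal_firing L \<zeta> (odometer k)" using step by simp
  have "legal_firing L \<zeta> (\<lambda>w. odometer k w + of_bool (k < depth w \<and> w \<noteq> p))"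
    by (rule wave[OF prev, of _ _ v]) (use step crit v lap_odometer_interior p in auto)
  moreover have "(\<lambda>w. odometer k w + of_bool (k < depth w \<and> w \<noteq> p)) = odometer (k + 1)"
    using step by (auto simp: fun_eq_iff odometer_def)
  ultimately show ?case by simp
qed

text \<open>
The waves stop once the landing vertex \<open>v\<close> lies on the boundary of the square of the last wave:
it has lost a grain to the outside, which compensates for the added one.
\<close>

lemma stable_after_full_waves:
  assumes le: "\<And>w. w \<in> box L \<Longrightarrow> \<zeta> w \<le> \<eta> w + of_bool (w = v)" and v: "1 \<le> depth v"
    and w: "w \<in> box L"
  shows "\<zeta> w + lap (odometer (depth v)) w \<le> 3"
proof -
  let ?l = "lap (odometer (depth v)) w"
  have k: "0 \<le> depth v" using v by simp
  consider "w = v" | "w \<noteq> v" "1 \<le> depth w" | "w \<noteq> v" "depth w = 0"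
    using depth_nonneg[of w] by linarith
  then show ?thesis
  proof cases
    case 1
    then show ?thesis using le[OF w] stable[OF w] lap_odometer_bounds(2)[OF k v] by simp
  next
    case 2
    then show ?thesis using le[OF w] stable[OF w] lap_odometer_bounds(1)[OF k 2(2)] by simp
  next
    case 3
    show ?thesis
    proof (cases "\<exists>z. adj w z \<and> 1 \<le> depth z")
      case True
      then have "\<eta> w \<le> 2" using surrounded[OF w 3(2)] by blast
      then show ?thesis using le[OF w] lap_odometer_bounds(4)[OF k 3(2)] 3 by simp
    next
      case False
      then show ?thesis using le[OF w] stable[OF w] lap_odometer_bounds(5)[OF k 3(2) False] 3 by simp
    qed
  qed
qed

text \<open>
The waves that skip the pit \<open>p\<close> once end in one of two ways: the landing vertex \<open>v\<close> lies on the
boundary of the last square, or \<open>v\<close> is the inner neighbour of \<open>p\<close> and lacks the grain from \<open>p\<close>.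
\<close>

lemma stable_after_stopped_waves:
  assumes le: "\<And>w. w \<in> box L \<Longrightarrow> \<zeta> w \<le> \<eta> w + of_bool (w = v)" and pit: "\<zeta> p = 0"
    and p: "1 \<le> depth p" "depth p \<le> k"
    and corner: "k = depth p \<or> \<not> has_inner_neighbour p"
    and v: "1 \<le> depth v" "v \<noteq> p" "depth v = k \<or> adj p v"
    and w: "w \<in> box L"
  shows "\<zeta> w + lap (\<lambda>w. odometer k w - of_bool (w = p)) w \<le> 3"
proof -
  have k: "0 \<le> k" using p by simp
  consider "w = p" | "w \<noteq> p" "w = v" | "w \<noteq> p" "w \<noteq> v" "1 \<le> depth w" | "w \<noteq> v" "w \<noteq> p" "depth w = 0"
    using depth_nonneg[of w] by linarith
  then show ?thesis
  proof cases
    case 1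
    have "lap (odometer k) p \<le> - 1"
      using corner lap_odometer_bounds(2)[OF k p(1)] lap_odometer_bounds(3)[OF k p] by auto
    then show ?thesis using pit by (simp add: 1 lap_odometer_minus_vertex adj_def)
  next
    case 2
    then show ?thesis
      using le[OF w] stable[OF w] lap_odometer_bounds(1)[OF k v(1)] lap_odometer_bounds(2)[OF k v(1)] v(3)
      by (auto simp: lap_odometer_minus_vertex)
  next
    case 3
    then show ?thesis using le[OF w] stable[OF w] lap_odometer_bounds(1)[OF k 3(3)] by (simp add: lap_odometer_minus_vertex)
  next
    case 4
    show ?thesis
    proof (cases "\<exists>z. adj w z \<and> 1 \<le> depth z")
      case True
      then have "\<eta> w \<le> 2" using surrounded[OF w 4(3)] by blast
      then show ?thesis using le[OF w] lap_odometer_bounds(4)[OF k 4(3)] 4 by (simp add: lap_odometer_minus_vertex)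
    next
      case False
      then show ?thesis
        using le[OF w] stable[OF w] lap_odometer_bounds(5)[OF k 4(3) False] 4 by (simp add: lap_odometer_minus_vertex)
    qed
  qed
qed

definition total :: "int \<Rightarrow> int" where
  "total k = (\<Sum>w\<in>box L. odometer k w)"

lemma avalanche_intact:
  assumes v: "1 \<le> depth v"
  shows "int (avalanche_size L \<eta> v) = total (depth v)"
proof -
  \<comment> \<open>any vertex outside the square serves as the absent pit\<close>
  let ?q = "(a - 1, b)"
  have q: "depth ?q = 0" by (simp add: depth_def)
  have "legal_firing L (add_grain v \<eta>) (odometer (depth v))"
    by (rule waves_outside_pit[of ?q _ v])
      (use v q critical in \<open>auto simp: add_grain_def\<close>)
  then show ?thesis
    unfolding total_def using stable stable_after_full_waves[of "add_grain v \<eta>" v] v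
    by (intro avalanche_size_eq) (auto simp: add_grain_def)
qed

text \<open>
The five cases: the grain fills the emptied vertex; the avalanche ends before it meets the
emptied vertex; it ends in the wave that meets it, which is one toppling short; it makes up for
the missing toppling; or it never does.
\<close>

lemma avalanche_removal:
  assumes v: "1 \<le> depth v" and p: "1 \<le> depth p"
  shows "int (avalanche_size L (removal p \<eta>) v) =
    (if v = p then 0
     else if depth v < depth p then total (depth v)
     else if depth v = depth p \<or> adj p v then total (depth p) - 1
     else if has_inner_neighbour p then total (depth v)
     else total (depth v) - 1)"
proof -
  let ?\<zeta> = "add_grain v (removal p \<eta>)"
  have pbox: "p \<in> box L" using p in_box by simp
  have crit: "3 \<le> ?\<zeta> w" if "1 \<le> depth w" "w \<noteq> p" for w
    using critical[OF that(1)] that by (auto simp: add_grain_def removal_def)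
  have nonneg: "0 \<le> removal p \<eta> w" if "w \<in> box L" for w
    using stable[OF that] by (auto simp: removal_def)
  have le: "?\<zeta> w \<le> \<eta> w + of_bool (w = v)" if "w \<in> box L" for w
    using stable[OF that] by (auto simp: add_grain_def removal_def)
  show ?thesis
  proof (cases "v = p")
    case True
    have "int (avalanche_size L (removal p \<eta>) v) = (\<Sum>w\<in>box L. 0)"
      by (rule avalanche_size_eq[OF legal_firing_zero nonneg])
        (use stable True in \<open>auto simp: add_grain_def removal_def lap_def\<close>)
    then show ?thesis using True by simp
  next
    case vp: False
    have pit: "?\<zeta> p = 0" and vcrit: "3 < ?\<zeta> v"
      using vp critical[OF v] by (auto simp: add_grain_def removal_def)
    have pit': "0 \<le> ?\<zeta> p" using pit by simp
    have minus: "(\<Sum>w\<in>box L. odometer k w - of_bool (w = p)) = total k - 1" for k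
      using pbox by (simp add: total_def sum_subtractf of_bool_def)
    consider (before) "depth v < depth p" | (stop) "depth p \<le> depth v" "depth v = depth p \<or> adj p v"
      | (edge) "depth p < depth v" "\<not> adj p v" "has_inner_neighbour p"
      | (corner) "depth p < depth v" "\<not> adj p v" "\<not> has_inner_neighbour p"
      by force
    then show ?thesis
    proof cases
      case before
      have "legal_firing L ?\<zeta> (odometer (depth v))"
        by (rule waves_outside_pit[OF crit pit' vcrit vp]) (use before v in auto)
      then have "int (avalanche_size L (removal p \<eta>) v) = total (depth v)"
        unfolding total_def by (rule avalanche_size_eq) (use nonneg stable_after_full_waves[OF le v] in auto)
      then show ?thesis using vp before by simp
    next
      case stop
      have "legal_firing L ?\<zeta> (\<lambda>w. odometer (depth p) w - of_bool (w = p))"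
        by (rule wave_around_pit[OF crit pit' vcrit vp p stop(1)])
      then have "int (avalanche_size L (removal p \<eta>) v) = total (depth p) - 1"
        unfolding minus[symmetric]
        by (rule avalanche_size_eq) (use nonneg stable_after_stopped_waves[OF le pit p _ _ v vp] stop in auto)
      then show ?thesis using vp stop by auto
    next
      case edge
      then obtain u where u: "adj p u" "depth u = depth p + 1" unfolding has_inner_neighbour_def by blast
      have "v \<noteq> u" using edge u by auto
      then have "legal_firing L ?\<zeta> (odometer (depth v))"
        by (intro waves_after_edge_pit[OF crit pit' vcrit vp _ p u]) (use edge in auto)
      then have "int (avalanche_size L (removal p \<eta>) v) = total (depth v)"
        unfolding total_def by (rule avalanche_size_eq) (use nonneg stable_after_full_waves[OF le v] in auto)
      then show ?thesis using vp edge by simp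
    next
      case corner
      have "legal_firing L ?\<zeta> (\<lambda>w. odometer (depth v) w - of_bool (w = p))"
        by (rule waves_after_corner_pit[OF crit pit' vcrit vp p corner(3)]) (use corner in auto)
      then have "int (avalanche_size L (removal p \<eta>) v) = total (depth v) - 1"
        unfolding minus[symmetric]
        by (rule avalanche_size_eq) (use nonneg stable_after_stopped_waves[OF le pit p _ _ v vp] corner in auto)
      then show ?thesis using vp corner by simp
    qed
  qed
qed

end

section \<open>The loss caused by a removal\<close>

context lattice_square begin

lemma card_region:
  assumes "0 \<le> k" "2 * k \<le> n"
  shows "int (card {w. k < depth w}) = (n - 2 * k)\<^sup>2"
  using assms by (simp add: depth_gt_region card_cartesian_product power2_eq_square)

lemma finite_region:
  assumes "0 \<le> k"
  shows "finite {w. k < depth w}"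
  using assms by (simp add: depth_gt_region)

lemma depth_le: "1 \<le> depth w \<Longrightarrow> 2 * depth w \<le> n + 1"
  using depth_ge_iff[of "depth w" w] by linarith

end

context square_generator begin

lemma total_step:
  assumes "0 \<le> k" "2 * k \<le> n"
  shows "total (k + 1) = total k + (n - 2 * k)\<^sup>2"
proof -
  have "{w. k < depth w} \<subseteq> box L" using in_box assms(1) by auto
  then have "box L \<inter> {w. k < depth w} = {w. k < depth w}" by blast
  then have "(\<Sum>w\<in>box L. of_bool (k < depth w)) = int (card {w. k < depth w})" by simp
  then show ?thesis
    unfolding total_def odometer_step[symmetric] sum.distrib card_region[OF assms] by simp
qed

text \<open>
The decrease of the sum of all avalanche sizes that is caused by the removal at \<open>p\<close>; minimizing
the stability ratio means maximizing it.
\<close>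

definition loss :: "vertex \<Rightarrow> int" where
  "loss p = (\<Sum>v | 1 \<le> depth v. int (avalanche_size L \<eta> v) - int (avalanche_size L (removal p \<eta>) v))"

text \<open>
The loss at the vertices of layer \<open>d\<close> that are not corners; the last summand is the number of
vertices of depth at least \<open>d\<close>.
\<close>

definition layer_loss :: "int \<Rightarrow> int" where
  "layer_loss d = total d + (n - 2 * (d - 1))\<^sup>2"

text \<open>
A grain landing on \<open>p\<close> loses its whole avalanche \<open>total d\<close>, where \<open>d = depth p\<close>. If \<open>p\<close> has no inner
neighbour, each other grain of depth at least \<open>d\<close> loses one toppling. If it has an inner
neighbour \<open>u\<close>, only the other grains of depth exactly \<open>d\<close> lose one; but the grain at \<open>u\<close> loses one
and in addition a whole wave of size \<open>(n - 2 * d)\<^sup>2\<close>, the number of vertices of depth more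
than \<open>d\<close>. So the sums agree up to one.
\<close>

lemma loss_eq:
  assumes p: "1 \<le> depth p"
  shows "loss p = layer_loss (depth p) - of_bool (\<not> has_inner_neighbour p)"
proof -
  define d where "d = depth p"
  let ?A = "{v. 1 \<le> depth v}"
  let ?\<Delta> = "\<lambda>v. int (avalanche_size L \<eta> v) - int (avalanche_size L (removal p \<eta>) v)"
  have fin: "finite ?A" using finite_region[of 0] by (simp add: int_one_le_iff_zero_less)
  have d: "1 \<le> d" "2 * d \<le> n + 1" using p depth_le[OF p] by (auto simp: d_def)
  have pA: "p \<in> ?A" using p by simp
  have layer: "(\<Sum>v\<in>?A. of_bool (d \<le> depth v)) = (n - 2 * (d - 1))\<^sup>2"
  proof -
    have "?A \<inter> {v. d \<le> depth v} = {v. d - 1 < depth v}" using d by auto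
    then show ?thesis using fin card_region[of "d - 1"] d by simp
  qed
  have self: "(\<Sum>v\<in>?A. c * of_bool (v = q)) = c" if "q \<in> ?A" for c :: int and q
    using fin that by (simp add: of_bool_def if_distrib cong: if_cong)
  have avalanches: "?\<Delta> v = total (depth v) - (if v = p then 0
     else if depth v < d then total (depth v)
     else if depth v = d \<or> adj p v then total d - 1
     else if has_inner_neighbour p then total (depth v)
     else total (depth v) - 1)" if "1 \<le> depth v" for v
    unfolding avalanche_intact[OF that] avalanche_removal[OF that p] d_def by simp
  show ?thesis
  proof (cases "has_inner_neighbour p")
    case False
    have "?\<Delta> v = of_bool (d \<le> depth v) + (total d - 1) * of_bool (v = p)" if "v \<in> ?A" for v
    proof -
      have "depth v = d" if "adj p v" "d \<le> depth v"
      proof -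
        have "depth v \<noteq> d + 1" using False that unfolding has_inner_neighbour_def d_def by blast
        then show ?thesis using depth_adj[OF that(1)] that(2) by (simp add: d_def)
      qed
      then show ?thesis using that False by (auto simp: avalanches d_def)
    qed
    then have "loss p = (\<Sum>v\<in>?A. of_bool (d \<le> depth v) + (total d - 1) * of_bool (v = p))"
      unfolding loss_def by (rule sum.cong[OF refl])
    also have "\<dots> = (n - 2 * (d - 1))\<^sup>2 + (total d - 1)"
      by (simp only: sum.distrib layer self[OF pA])
    finally show ?thesis using False by (simp add: layer_loss_def d_def)
  next
    case True
    then obtain u where u: "adj p u" "depth u = d + 1"
      unfolding has_inner_neighbour_def d_def by blast
    have uA: "u \<in> ?A" and ne: "u \<noteq> p" using u d by (auto simp: d_def)
    have n: "2 * d \<le> n" using depth_le[of u] u d by simp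
    have "?\<Delta> v = of_bool (d \<le> depth v) - of_bool (d < depth v) + (total d - 1) * of_bool (v = p)
        + ((n - 2 * d)\<^sup>2 + 1) * of_bool (v = u)" if v: "v \<in> ?A" for v
    proof -
      have adj_u: "v = u" if "adj p v" "d < depth v"
      proof -
        have "depth v = d + 1" using depth_adj[OF that(1)] that(2) by (simp add: d_def)
        then show ?thesis using inner_neighbour_unique[OF that(1) u(1)] u(2) by (simp add: d_def)
      qed
      consider "v = p" | "v = u" | "v \<noteq> p" "v \<noteq> u" by blast
      then show ?thesis
      proof cases
        case 1
        then show ?thesis using v ne by (simp add: avalanches d_def)
      next
        case 2
        then show ?thesis using v ne u d n total_step[of d] by (simp add: avalanches)
      next
        case 3
        then show ?thesis using v True adj_u by (auto simp: avalanches)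
      qed
    qed
    then have "loss p = (\<Sum>v\<in>?A. of_bool (d \<le> depth v) - of_bool (d < depth v) + (total d - 1) * of_bool (v = p)
        + ((n - 2 * d)\<^sup>2 + 1) * of_bool (v = u))"
      unfolding loss_def by (rule sum.cong[OF refl])
    also have "\<dots> = (n - 2 * (d - 1))\<^sup>2 - (\<Sum>v\<in>?A. of_bool (d < depth v)) + (total d - 1) + ((n - 2 * d)\<^sup>2 + 1)"
      by (simp only: sum.distrib sum_subtractf layer self[OF pA] self[OF uA])
    also have "(\<Sum>v\<in>?A. of_bool (d < depth v)) = (n - 2 * d)\<^sup>2"
    proof -
      have "?A \<inter> {v. d < depth v} = {v. d < depth v}" using d by auto
      then show ?thesis using fin card_region[of d] d n by simp
    qed
    finally show ?thesis using True by (simp add: layer_loss_def d_def)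
  qed
qed

text \<open>
With \<open>y = n - 2 * d\<close>, the side of the square inside layer \<open>d\<close>, the difference is
\<open>2 * y\<^sup>2 - (y + 2)\<^sup>2 = (y - 2)\<^sup>2 - 8\<close>: positive for \<open>y \<ge> 5\<close>, negative for
\<open>0 \<le> y \<le> 4\<close>. This is where the third ring comes from: going inwards pays off until the side of
the square is 5 or 6.
\<close>

lemma layer_loss_step:
  assumes "1 \<le> d" "2 * d \<le> n"
  shows "layer_loss (d + 1) - layer_loss d = (n - 2 * d - 2)\<^sup>2 - 8"
  using total_step[of d] assms by (simp add: layer_loss_def power2_eq_square algebra_simps)

lemma layer_loss_increasing:
  assumes "1 \<le> d" "2 * d + 5 \<le> n"
  shows "layer_loss d < layer_loss (d + 1)"
proof -
  have "3 * 3 \<le> (n - 2 * d - 2) * (n - 2 * d - 2)"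
    using assms by (intro mult_mono) auto
  then show ?thesis
    using layer_loss_step[of d] assms by (simp add: power2_eq_square)
qed

lemma layer_loss_decreasing:
  assumes "1 \<le> d" "2 * d \<le> n" "n \<le> 2 * d + 4"
  shows "layer_loss (d + 1) < layer_loss d"
proof -
  have "(n - 2 * d - 2)\<^sup>2 \<le> 2\<^sup>2"
    using assms by (intro power2_le_iff_abs_le[THEN iffD2]) auto
  then show ?thesis using layer_loss_step[of d] assms by simp
qed

text \<open>
The assumptions on \<open>e\<close> say that the square inside layer \<open>e\<close> has side at most 4, and that the one
inside layer \<open>e - 1\<close>, if this is a layer, has side at least 5.
\<close>

lemma layer_loss_peak:
  assumes peak: "1 \<le> e" "n \<le> 2 * e + 4" "e = 1 \<or> 2 * e + 3 \<le> n"
    and d: "1 \<le> d" "2 * d \<le> n + 1" "d \<noteq> e"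
  shows "layer_loss d < layer_loss e"
proof (cases "d < e")
  case True
  have *: "layer_loss d < layer_loss j" if "d + 1 \<le> j" "j \<le> e" for j
    using that
  proof (induction j rule: int_ge_induct)
    case base
    then show ?case using layer_loss_increasing[of d] d peak by auto
  next
    case (step i)
    then show ?case using layer_loss_increasing[of i] d peak by auto
  qed
  then show ?thesis using True by auto
next
  case False
  have *: "layer_loss j < layer_loss e" if "e + 1 \<le> j" "j \<le> d" for j
    using that
  proof (induction j rule: int_ge_induct)
    case base
    then show ?case using layer_loss_decreasing[of e] d peak by auto
  next
    case (step i)
    then show ?case using layer_loss_decreasing[of i] d peak by auto
  qed
  then show ?thesis using False d(3) by auto
qed

lemma expected_avalanche_eq:
  assumes "n \<ge> 1"
  shows "expected_avalanche L \<xi> {w. 1 \<le> depth w}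
    = (\<Sum>v | 1 \<le> depth v. real (avalanche_size L \<xi> v)) / card {w. 1 \<le> depth w}"
proof -
  let ?A = "{w. 1 \<le> depth w}"
  have ab: "(a, b) \<in> ?A" using assms by (simp add: depth_def)
  have A: "box L \<inter> ?A = ?A" using in_box by blast
  have fin: "finite ?A" using finite_region[of 0] by (simp add: int_one_le_iff_zero_less)
  have "cond_pmf (pmf_of_set (box L)) ?A = pmf_of_set ?A"
  proof (rule pmf_eqI)
    fix v
    have ne: "box L \<noteq> {}" "?A \<noteq> {}" using A ab by blast+
    then have meet: "set_pmf (pmf_of_set (box L)) \<inter> ?A \<noteq> {}" by (simp only: set_pmf_of_set finite_box A not_False_eq_True)
    have "card (box L) \<noteq> 0" using ne by simp
    then show "pmf (cond_pmf (pmf_of_set (box L)) ?A) v = pmf (pmf_of_set ?A) v"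
      using ne fin in_box[of v]
      by (simp add: pmf_cond[OF meet] measure_pmf_of_set A indicator_def)
  qed
  then show ?thesis
    unfolding expected_avalanche_def using ab fin by (subst integral_pmf_of_set[symmetric]) auto
qed

text \<open>
All stability ratios have the same positive denominator, so comparing them amounts to comparing
losses.
\<close>

lemma cornerstones_iff:
  assumes "n \<ge> 1"
  shows "p \<in> cornerstones L \<eta> {w. 1 \<le> depth w} \<longleftrightarrow>
    1 \<le> depth p \<and> (\<forall>q. 1 \<le> depth q \<longrightarrow> loss q \<le> loss p)"
proof -
  let ?A = "{w. 1 \<le> depth w}"
  let ?S = "\<lambda>\<xi>. \<Sum>v\<in>?A. real (avalanche_size L \<xi> v)"
  let ?r = "stability_ratio L \<eta> ?A"
  have ab: "(a, b) \<in> ?A" using assms by (simp add: depth_def)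
  have fin: "finite ?A" using finite_region[of 0] by (simp add: int_one_le_iff_zero_less)
  have card: "card ?A > 0" using ab fin by (auto simp: card_gt_0_iff)
  have pos: "0 < ?S \<eta>"
  proof (rule sum_pos2[OF fin ab])
    have "1 \<le> odometer (depth (a, b)) (a, b)" using ab by (simp add: odometer_def)
    also have "\<dots> \<le> total (depth (a, b))"
      unfolding total_def using ab in_box depth_nonneg
      by (intro member_le_sum) (auto simp: odometer_def)
    finally have "1 \<le> int (avalanche_size L \<eta> (a, b))" using avalanche_intact[of "(a, b)"] ab by simp
    then show "0 < real (avalanche_size L \<eta> (a, b))" by simp
  qed simp
  have r: "?r q = (?S \<eta> - loss q) / ?S \<eta>" for q
  proof -
    have "real_of_int (loss q) = ?S \<eta> - ?S (removal q \<eta>)"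
      by (simp add: loss_def sum_subtractf)
    then show ?thesis
      unfolding stability_ratio_def expected_avalanche_eq[OF assms] using card by simp
  qed
  have le: "?r p \<le> ?r q \<longleftrightarrow> loss q \<le> loss p" for q
    unfolding r using pos by (simp add: divide_le_cancel)
  have "?r p = Min (?r ` ?A) \<longleftrightarrow> (\<forall>q\<in>?A. ?r p \<le> ?r q)" if "p \<in> ?A"
  proof
    assume "?r p = Min (?r ` ?A)"
    then show "\<forall>q\<in>?A. ?r p \<le> ?r q" using fin by simp
  next
    assume "\<forall>q\<in>?A. ?r p \<le> ?r q"
    then show "?r p = Min (?r ` ?A)" using fin that by (intro Min_eqI[symmetric]) auto
  qed
  then show ?thesis unfolding cornerstones_def stability_level_def using le by auto
qed

text \<open>
The square is a single layer of corners, so all losses agree.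
\<close>

lemma cornerstones_side_1_2:
  assumes "n = 1 \<or> n = 2"
  shows "cornerstones L \<eta> {w. 1 \<le> depth w} = {w. 1 \<le> depth w}"
proof -
  have "loss q = layer_loss 1 - 1" if "1 \<le> depth q" for q
  proof -
    have le: "depth w \<le> 1" for w using depth_le[of w] assms by (cases "1 \<le> depth w") auto
    have "depth q = 1" using that le[of q] by simp
    moreover have "depth u \<noteq> 2" for u using le[of u] by simp
    ultimately have "depth q = 1" "\<not> has_inner_neighbour q"
      unfolding has_inner_neighbour_def by simp_all
    then show ?thesis using loss_eq[OF that] by simp
  qed
  then show ?thesis using cornerstones_iff assms by auto
qed

text \<open>
Corners lose one less than the other vertices of their layer, and those lose most on layer \<open>e\<close>.
Such vertices exist, since the square of layer \<open>e\<close> has side at least 3.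
\<close>

lemma cornerstones_side_ge_3:
  assumes n: "3 \<le> n" and peak: "1 \<le> e" "n \<le> 2 * e + 4" "e = 1 \<or> 2 * e + 3 \<le> n"
  shows "cornerstones L \<eta> {w. 1 \<le> depth w} = {w. depth w = e \<and> has_inner_neighbour w}"
proof -
  \<comment> \<open>next to the lower left corner of layer \<open>e\<close>, along its left side\<close>
  let ?w = "(a + e - 1, b + e)" and ?u = "(a + e, b + e)"
  have "2 * e + 1 \<le> n" using n peak by auto
  then have "depth ?w = e" "depth ?u = e + 1" using peak by (auto simp: depth_def)
  moreover have "adj ?w ?u" by (simp add: adj_def)
  ultimately have w: "depth ?w = e" "has_inner_neighbour ?w"
    unfolding has_inner_neighbour_def by auto
  have max: "loss q \<le> layer_loss e" if "1 \<le> depth q" for q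
    using loss_eq[OF that] layer_loss_peak[OF peak that depth_le[OF that]]
    by (cases "depth q = e") auto
  have eq: "loss q = layer_loss e \<longleftrightarrow> depth q = e \<and> has_inner_neighbour q" if "1 \<le> depth q" for q
    using loss_eq[OF that] layer_loss_peak[OF peak that depth_le[OF that]]
    by (cases "depth q = e") auto
  have "p \<in> cornerstones L \<eta> {w. 1 \<le> depth w} \<longleftrightarrow> depth p = e \<and> has_inner_neighbour p" for p
  proof -
    have "n \<ge> 1" using n by simp
    have "(\<forall>q. 1 \<le> depth q \<longrightarrow> loss q \<le> loss p) \<longleftrightarrow> loss p = layer_loss e" if "1 \<le> depth p"
      using max that eq[of ?w] w peak(1) by (metis order.eq_iff)
    then show ?thesis using cornerstones_iff[OF \<open>n \<ge> 1\<close>, of p] eq[of p] peak(1) by auto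
  qed
  then show ?thesis by blast
qed

end

section \<open>Rings as layers\<close>

context lattice_square begin

text \<open>
This translates the counting of outside neighbours, by which corners and inner boundaries are
defined, into depths. It fails on a square of side 1, whose vertex has four outside neighbours. In the last case both coordinates of \<open>w\<close> are extreme in the square, since
otherwise \<open>w\<close> or a neighbour would lie deeper.
\<close>

lemma card_outside_neighbours:
  assumes side: "2 * k + 1 \<le> n" and k: "1 \<le> k" and w: "k \<le> depth w"
  shows "card {z. adj w z \<and> \<not> k \<le> depth z} =
    (if k < depth w then 0 else if has_inner_neighbour w then 1 else 2)"
proof -
  consider "k < depth w" | "depth w = k" "has_inner_neighbour w" | "depth w = k" "\<not> has_inner_neighbour w"
    using w by linarith
  then show ?thesis
  proof cases
    case 1
    have "k \<le> depth z" if "adj w z" for z using depth_adj[OF that] 1 by linarith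
    then have none: "{z. adj w z \<and> \<not> k \<le> depth z} = {}" by blast
    show ?thesis unfolding none using 1 by simp
  next
    case 2
    then obtain u where u: "adj w u" "depth u = depth w + 1" unfolding has_inner_neighbour_def by blast
    have w1: "1 \<le> depth w" using k w by simp
    obtain z0 where z0: "adj w z0" "depth z0 = depth w - 1" using outer_neighbour[OF w1] by blast
    have "z = z0" if "adj w z" "\<not> k \<le> depth z" for z
    proof -
      have "depth z = depth w - 1" using depth_adj[OF that(1)] that(2) 2 by linarith
      then show ?thesis using opposite_outer_unique[OF w1 u that(1) z0(1)] z0(2) by simp
    qed
    moreover have "\<not> k \<le> depth z0" using z0 2 by simp
    ultimately have one: "{z. adj w z \<and> \<not> k \<le> depth z} = {z0}" using z0(1) by blast
    show ?thesis unfolding one using 2 by simp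
  next
    case 3
    obtain x y where xy: "w = (x, y)" by fastforce
    have k': "1 \<le> k + 1" using k by simp
    have "\<not> k + 1 \<le> depth w" using 3 by simp
    moreover have "\<not> k + 1 \<le> depth z" if "adj w z" for z
    proof -
      have "depth z \<noteq> depth w + 1" using 3 that unfolding has_inner_neighbour_def by blast
      then show ?thesis using depth_adj[OF that] 3 by linarith
    qed
    ultimately have no: "\<not> k + 1 \<le> depth (x, y)" "\<not> k + 1 \<le> depth (x + 1, y)" "\<not> k + 1 \<le> depth (x - 1, y)"
      "\<not> k + 1 \<le> depth (x, y + 1)" "\<not> k + 1 \<le> depth (x, y - 1)"
      by (auto simp: xy adj_iff)
    define lx hx ly hy where "lx = a + k - 1" and "hx = a + n - k" and "ly = b + k - 1" and "hy = b + n - k"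
    have in_box: "lx \<le> x" "x \<le> hx" "ly \<le> y" "y \<le> hy"
      using w unfolding depth_ge_iff[OF k] by (auto simp: xy lx_def hx_def ly_def hy_def)
    have far: "lx + 2 \<le> hx" "ly + 2 \<le> hy" using side by (auto simp: lx_def hx_def ly_def hy_def)
    have deep: "k + 1 \<le> depth (s, t)" if "lx < s" "s < hx" "ly < t" "t < hy" for s t
      using that unfolding depth_ge_iff[OF k'] by (simp add: lx_def hx_def ly_def hy_def)
    have x: "x = lx \<or> x = hx"
    proof (rule ccontr)
      assume "\<not> ?thesis"
      then have "lx < x" "x < hx" using in_box by auto
      note deep = deep[OF this]
      consider "y = ly" | "y = hy" | "ly < y" "y < hy" using in_box by linarith
      then show False using no deep[of "y + 1"] deep[of "y - 1"] deep[of y] far by cases auto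
    qed
    have y: "y = ly \<or> y = hy"
    proof (rule ccontr)
      assume "\<not> ?thesis"
      then have "ly < y" "y < hy" using in_box by auto
      note deep = deep[OF _ _ this]
      consider "x = lx" | "x = hx" | "lx < x" "x < hx" using in_box by linarith
      then show False using no deep[of "x + 1"] deep[of "x - 1"] deep[of x] far by cases auto
    qed
    have "{z. adj w z \<and> \<not> k \<le> depth z} =
      {(if x = lx then x - 1 else x + 1, y), (x, if y = ly then y - 1 else y + 1)}"
      (is "?L = ?R")
    proof -
      have ge: "k \<le> depth z \<longleftrightarrow> lx \<le> fst z \<and> fst z \<le> hx \<and> ly \<le> snd z \<and> snd z \<le> hy" for z
        unfolding depth_ge_iff[OF k] by (simp add: lx_def hx_def ly_def hy_def)
      have "z \<in> ?L \<longleftrightarrow> z \<in> ?R" for z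
        using x y far in_box unfolding mem_Collect_eq ge adj_iff xy by auto
      then show ?thesis by blast
    qed
    moreover have "card {(if x = lx then x - 1 else x + 1, y), (x, if y = ly then y - 1 else y + 1)} = 2" by simp
    ultimately have two: "card {z. adj w z \<and> \<not> k \<le> depth z} = 2" by (simp only:)
    show ?thesis unfolding two using 3 by simp
  qed
qed

lemma corners_region:
  assumes "2 * k + 1 \<le> n" "1 \<le> k"
  shows "corners {w. k \<le> depth w} = {w. depth w = k \<and> \<not> has_inner_neighbour w}"
  using card_outside_neighbours[OF assms] by (auto simp: corners_def split: if_splits)

lemma outer_layer:
  assumes "2 * k + 1 \<le> n" "1 \<le> k"
  shows "inner_boundary {w. k \<le> depth w} \<union> corners {w. k \<le> depth w} = {w. depth w = k}"
  using card_outside_neighbours[OF assms]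
  by (auto simp: corners_def inner_boundary_def split: if_splits)

text \<open>
Rings are numbered from the centre outwards, layers from the boundary inwards. The recursion
peels off one layer at a time, down to the innermost square of side 1 or 2.
\<close>

lemma ring_eq_layer:
  assumes N: "n = int N" and m: "m = nat \<lceil>real N / 2\<rceil>" and j: "1 \<le> j" "j \<le> m"
  shows "ring N {w. 1 \<le> depth w} j = {w. depth w = int m - int j + 1}"
  using j
proof (induction "m - j" arbitrary: j rule: less_induct)
  case less
  let ?A = "{w. 1 \<le> depth w}"
  have m2: "n \<le> 2 * int m" "2 * int m \<le> n + 1" unfolding m N by linarith+
  have dm: "depth w \<le> int m" if "1 \<le> depth w" for w using depth_le[OF that] m2 by linarith
  have outer: "?A - (\<Union>k\<in>{i + 1..m}. ring N ?A k) = {w. int m - int i + 1 \<le> depth w}"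
    if "j \<le> i" "i \<le> m" "1 \<le> i" for i
  proof -
    have IH: "ring N ?A k = {w. depth w = int m - int k + 1}" if "k \<in> {i + 1..m}" for k
      using less(1)[of k] that \<open>j \<le> i\<close> by auto
    have "w \<in> (\<Union>k\<in>{i + 1..m}. ring N ?A k) \<longleftrightarrow> depth w \<le> int m - int i" if w: "1 \<le> depth w" for w
    proof
      assume "w \<in> (\<Union>k\<in>{i + 1..m}. ring N ?A k)"
      then show "depth w \<le> int m - int i" using IH by auto
    next
      assume le: "depth w \<le> int m - int i"
      define k where "k = nat (int m - depth w + 1)"
      have "k \<in> {i + 1..m}" "depth w = int m - int k + 1" using le w dm[OF w] by (auto simp: k_def)
      then show "w \<in> (\<Union>k\<in>{i + 1..m}. ring N ?A k)" using IH by blast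
    qed
    then have "?A - (\<Union>k\<in>{i + 1..m}. ring N ?A k) = {w. 1 \<le> depth w \<and> \<not> depth w \<le> int m - int i}"
      by blast
    also have "\<dots> = {w. int m - int i + 1 \<le> depth w}" using that by auto
    finally show ?thesis .
  qed
  show ?case
  proof (cases "j = 1")
    case True
    have "ring N ?A 1 = ?A - (\<Union>k\<in>{1 + 1..m}. ring N ?A k)"
      by (subst ring.simps) (simp add: m Let_def numeral_2_eq_2)
    also have "\<dots> = {w. int m \<le> depth w}" using outer[of 1] True less.prems by simp
    also have "\<dots> = {w. depth w = int m}" using dm less.prems by (force intro: antisym)
    finally show ?thesis using True by simp
  next
    case False
    let ?B = "{w. int m - int j + 1 \<le> depth w}"
    have "ring N ?A j = inner_boundary ?B \<union> corners ?B"
      using False less.prems outer[of j]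
      by (subst ring.simps) (simp add: m[symmetric] Let_def)
    also have "\<dots> = {w. depth w = int m - int j + 1}"
      by (rule outer_layer) (use False less.prems m2 in auto)
    finally show ?thesis .
  qed
qed

end

section \<open>Cornerstones of square generators\<close>

text \<open>
Adding to a generator a critical vertex adjacent to it would give a larger connected set of
critical vertices.
\<close>

lemma square_generatorI:
  assumes stable: "\<eta> \<in> stable_sandpiles L" and gen: "generator L \<eta> A"
    and A: "A = {w. 1 \<le> lattice_square.depth a b n w}"
  shows "square_generator a b n L \<eta>"
proof
  interpret lattice_square a b n .
  have crit: "w \<in> box L \<and> \<eta> w = 3" if "1 \<le> depth w" for w
    using gen that unfolding generator_def critical_vertices_def A by blast
  show "w \<in> box L" "\<eta> w = 3" if "1 \<le> depth w" for w using crit[OF that] by auto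
  show bounds: "0 \<le> \<eta> w \<and> \<eta> w \<le> 3" if "w \<in> box L" for w
    using stable that by (force simp: stable_sandpiles_def)
  show "\<eta> w \<le> 2" if w: "w \<in> box L" "depth w = 0" "adj w z" "1 \<le> depth z" for w z
  proof (rule ccontr)
    assume "\<not> \<eta> w \<le> 2"
    then have w3: "\<eta> w = 3" using bounds[OF w(1)] by simp
    let ?S = "insert w A"
    define R where "R = {(a, b). a \<in> ?S \<and> b \<in> ?S \<and> adj a b}"
    have zA: "z \<in> A" using w by (simp add: A)
    have in_A: "(x, y) \<in> R\<^sup>*" if "x \<in> A" "y \<in> A" for x y
    proof -
      have "(x, y) \<in> {(a, b). a \<in> A \<and> b \<in> A \<and> adj a b}\<^sup>*"
        using gen that by (simp add: generator_def lattice_connected_def)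
      then show ?thesis by (rule rtrancl_mono[THEN subsetD, rotated]) (auto simp: R_def)
    qed
    have "(w, z) \<in> R" "(z, w) \<in> R" using zA w adj_sym[of w z] by (auto simp: R_def)
    then have "(x, z) \<in> R\<^sup>*" "(z, x) \<in> R\<^sup>*" if "x \<in> ?S" for x
      using that in_A[of x z] in_A[of z x] zA by (cases "x = w"; auto)+
    then have "lattice_connected ?S"
      unfolding lattice_connected_def R_def[symmetric] by (meson rtrancl_trans)
    moreover have "?S \<subseteq> critical_vertices L \<eta>"
      using gen w(1) w3 by (auto simp: generator_def critical_vertices_def)
    ultimately have "?S = A" using gen unfolding generator_def by blast
    then have "w \<in> A" by blast
    then show False using w(2) by (simp add: A)
  qed
qed

theorem theorem4p6:
  fixes L N :: nat and \<eta> :: sandpile and A :: "vertex set"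
  assumes "L \<ge> 1" and "N \<ge> 1"
    and "\<eta> \<in> stable_sandpiles L"
    and "generator L \<eta> A"
    and "is_square N A"
  shows "cornerstones L \<eta> A =
    (if N = 1 \<or> N = 2 then ring N A 1
     else if N = 3 \<or> N = 4 then ring N A 2 - corners A
     else ring N A 3 - corners (\<Union>i\<in>{1..3}. ring N A i))"
proof -
  obtain a b where "A = {a..<a + int N} \<times> {b..<b + int N}"
    using assms(5) by (auto simp: is_square_def)
  then have A: "A = {w. 1 \<le> lattice_square.depth a b (int N) w}"
    using lattice_square.depth_gt_region[of 0 a b "int N"]
    by (simp add: int_one_le_iff_zero_less)
  interpret square_generator a b "int N" L \<eta>
    by (rule square_generatorI[OF assms(3,4) A])
  define m where "m = nat \<lceil>real N / 2\<rceil>"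
  have m: "int N \<le> 2 * int m" "2 * int m \<le> int N + 1" unfolding m_def by linarith+
  have ring: "ring N A j = {w. depth w = int m - int j + 1}" if "1 \<le> j" "j \<le> m" for j
    unfolding A by (rule ring_eq_layer[OF refl m_def that])
  have dm: "depth w \<le> int m" if "1 \<le> depth w" for w using depth_le[OF that] m by linarith
  consider "N = 1 \<or> N = 2" | "N = 3 \<or> N = 4" | "5 \<le> N" using assms(2) by linarith
  then show ?thesis
  proof cases
    case 1
    then have "m = 1" using m by auto
    then have "ring N A 1 = A" using ring[of 1] dm by (force simp: A intro: antisym)
    moreover have "cornerstones L \<eta> A = A"
      unfolding A by (rule cornerstones_side_1_2) (use 1 in auto)
    ultimately show ?thesis using 1 by simp
  next
    case 2
    then have "m = 2" using m by auto
    then have "ring N A 2 - corners A = {w. depth w = 1 \<and> has_inner_neighbour w}"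
      using ring[of 2] corners_region[of 1] 2 unfolding A by auto
    moreover have "cornerstones L \<eta> A = {w. depth w = 1 \<and> has_inner_neighbour w}"
      unfolding A by (rule cornerstones_side_ge_3) (use 2 in auto)
    moreover have "\<not> (N = 1 \<or> N = 2)" using 2 by auto
    ultimately show ?thesis using 2 by (simp only: if_True if_False)
  next
    case 3
    \<comment> \<open>ring 3 is layer \<open>m - 2\<close>\<close>
    define e where "e = int m - 2"
    have e: "1 \<le> e" "int N \<le> 2 * e + 4" "2 * e + 3 \<le> int N" using m 3 by (auto simp: e_def)
    have rings: "ring N A i = {w. depth w = e + 3 - int i}" if "i \<in> {1..3}" for i
    proof -
      have "1 \<le> i" "i \<le> m" using that e(1) by (auto simp: e_def)
      then show ?thesis by (simp add: ring e_def algebra_simps)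
    qed
    have "{1..3} = {1, 2, 3 :: nat}" by auto
    then have "(\<Union>i\<in>{1..3}. ring N A i) = {w. depth w = e + 2 \<or> depth w = e + 1 \<or> depth w = e}"
      by (auto simp: rings)
    also have "\<dots> = {w. e \<le> depth w}"
    proof -
      have "depth w \<le> e + 2" if "e \<le> depth w" for w using dm[of w] e(1) that by (simp add: e_def)
      then show ?thesis by force
    qed
    finally have "ring N A 3 - corners (\<Union>i\<in>{1..3}. ring N A i)
        = {w. depth w = e \<and> has_inner_neighbour w}"
      using e corners_region[of e] by (auto simp: rings)
    moreover have "cornerstones L \<eta> A = {w. depth w = e \<and> has_inner_neighbour w}"
      unfolding A by (rule cornerstones_side_ge_3) (use e 3 in auto)
    moreover have "\<not> (N = 1 \<or> N = 2)" "\<not> (N = 3 \<or> N = 4)" using 3 by auto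
    ultimately show ?thesis by (simp only: if_False)
  qed
qed

end
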